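(* Let $d, k, r$ be positive integers with $k < d$ and $r \ge k+1$. Then, as $n\to\infty$, $f_{\mathrm{lin}}(n,d,k,r) = \Omega(g_{d,k,r}(n))$, where $$g_{d,k,r}(n) = \begin{cases} n^{d(r-k)/(r-1)}, & \text{if } r < d,\\ n^{d(d-k)/(d-1)}/(\log n)^{1/(d-1)}, & \text{otherwise.}\end{cases}$$ In particular, if $r = k+1$, then $f_{\mathrm{lin}}(n,d,k,k+1) = \Omega(g_{d,k}(n))$, where $$g_{d,k}(n) = \begin{cases} n^{d(d-k)/(d-1)}/(\log n)^{1/(d-1)}, & \text{if } k = d-1,\\ n^{d/k}, & \text{otherwise.}\end{cases}$$
   Context: $[n] = \{1,\dots,n\}$. For positive integers $n,d,k,r$ with $k<d$ and $r \ge k+1$, $f_{\mathrm{lin}}(n,d,k,r)$ is the maximum size of a subset of $[n]^d\subset\mathbb{R}^d$ such that every $k$-dimensional linear subspace of $\mathbb{R}^d$ contains at most $r-1$ points of the subset. Here $d,k,r$ are fixed and $n\to\infty$; implied constants may depend on $d,k,r$. *)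

theory Defs
  imports "HOL-Analysis.Analysis" "HOL-Library.Landau_Symbols"
begin

definition grid :: "nat \<Rightarrow> (real ^ 'd::finite) set" where
  "grid n = {x. \<forall>i. \<exists>m\<in>{1..n}. x $ i = real m}"

definition admissible :: "nat \<Rightarrow> nat \<Rightarrow> nat \<Rightarrow> (real ^ 'd::finite) set \<Rightarrow> bool" where
  "admissible n k r S \<longleftrightarrow>
     S \<subseteq> grid n \<and> (\<forall>V. subspace V \<and> dim V = k \<longrightarrow> card (S \<inter> V) \<le> r - 1)"

text \<open>The dimension \<open>d\<close> of the ambient space is \<open>CARD('d)\<close>, so \<open>f_lin TYPE('d) n k r\<close> is
  $f_{\mathrm{lin}}(n,d,k,r)$.\<close>

definition f_lin :: "'d::finite itself \<Rightarrow> nat \<Rightarrow> nat \<Rightarrow> nat \<Rightarrow> nat" where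
  "f_lin T n k r = Max {card S | S :: (real ^ 'd) set. admissible n k r S}"

definition g_dkr :: "nat \<Rightarrow> nat \<Rightarrow> nat \<Rightarrow> nat \<Rightarrow> real" where
  "g_dkr d k r n =
     (if r < d then real n powr (real d * (real r - real k) / (real r - 1))
      else real n powr (real d * (real d - real k) / (real d - 1))
             / ln (real n) powr (1 / (real d - 1)))"

definition g_dk :: "nat \<Rightarrow> nat \<Rightarrow> nat \<Rightarrow> real" where
  "g_dk d k n =
     (if k = d - 1 then real n powr (real d * (real d - real k) / (real d - 1))
                          / ln (real n) powr (1 / (real d - 1))
      else real n powr (real d / real k))"

text \<open>The maximum in \<open>f_lin\<close> ranges over a finite nonempty set, so it is attained.\<close>

lemma finite_grid: "finite (grid n :: (real ^ 'd::finite) set)"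
proof -
  have "grid n \<subseteq> (vec_lambda ` (UNIV \<rightarrow>\<^sub>E real ` {1..n}) :: (real ^ 'd) set)"
  proof
    fix x :: "real ^ 'd" assume "x \<in> grid n"
    then have "($) x \<in> UNIV \<rightarrow>\<^sub>E real ` {1..n}"
      by (auto simp: grid_def PiE_def)
    then have "vec_lambda (($) x) \<in> vec_lambda ` (UNIV \<rightarrow>\<^sub>E real ` {1..n})"
      by (rule imageI)
    then show "x \<in> vec_lambda ` (UNIV \<rightarrow>\<^sub>E real ` {1..n})"
      by (simp add: vec_nth_inverse)
  qed
  then show ?thesis
    by (rule finite_subset) (intro finite_imageI finite_PiE; simp)
qed

lemma f_lin_max:
  fixes T :: "'d::finite itself"
  shows "\<exists>S :: (real ^ 'd) set. admissible n k r S \<and> card S = f_lin T n k r"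
    and "admissible n k r (S :: (real ^ 'd) set) \<Longrightarrow> card S \<le> f_lin T n k r"
proof -
  let ?A = "{card S | S :: (real ^ 'd) set. admissible n k r S}"
  have "?A \<subseteq> card ` Pow (grid n :: (real ^ 'd) set)"
    by (auto simp: admissible_def)
  then have fin: "finite ?A"
    by (rule finite_subset) (simp add: finite_grid)
  have "admissible n k r ({} :: (real ^ 'd) set)"
    by (simp add: admissible_def)
  then have "?A \<noteq> {}" by blast
  from Max_in[OF fin this]
  show "\<exists>S :: (real ^ 'd) set. admissible n k r S \<and> card S = f_lin T n k r"
    by (auto simp: f_lin_def)
  show "card S \<le> f_lin T n k r" if "admissible n k r (S :: (real ^ 'd) set)"
    unfolding f_lin_def by (rule Max_ge[OF fin]) (use that in blast)
qed

end

theory Submission imports Defs begin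

text \<open>Since \<open>f_lin\<close> is monotone in \<open>r\<close>, one may assume \<open>r \<le> d\<close>. By the deletion method it suffices to
  show that \<open>O(n ^ (d k))\<close> of the \<open>r\<close>-tuples of grid points (times \<open>log n\<close> if \<open>r = d\<close>) lie in a common
  \<open>k\<close>-dimensional subspace. The integer points of such a subspace have a reduced basis
  \<open>b\<^sub>1, \<dots>, b\<^sub>k\<close>, so the tuple, as an \<open>r \<times> d\<close> matrix, is a sum of \<open>k\<close> integral rank-one matrices
  \<open>a\<^sub>i b\<^sub>i\<^sup>T\<close> with \<open>\<bar>a\<^sub>i\<bar> \<bar>b\<^sub>i\<bar> = O(n)\<close>. If \<open>a\<^sub>q\<close> is the shortest of the \<open>a\<^sub>i\<close> and \<open>p\<close> is its largest coordinate,
  the other \<open>a\<^sub>i\<close> can be reduced modulo \<open>a\<^sub>q\<close> in coordinate \<open>p\<close>. For \<open>\<bar>a\<^sub>q\<bar> \<approx> 2 ^ j\<close> each reduced pair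
  \<open>(a\<^sub>i, b\<^sub>i)\<close> then has only \<open>O(n ^ d)\<close> choices, while \<open>(a\<^sub>q, b\<^sub>q)\<close> has \<open>O(n ^ d 2 ^ (- j (d - r)))\<close>; it
  remains to sum over the \<open>O(log n)\<close> values of \<open>j\<close>.\<close>

subsection \<open>Reduced bases\<close>

text \<open>A discrete subgroup with an explicit gap \<open>\<delta>\<close>. Abstract subgroups are
  used because the induction passes to orthogonal projections, whose images need not be
  integral.\<close>

definition separated_subgroup :: "real \<Rightarrow> 'a::real_inner set \<Rightarrow> bool" where
  "separated_subgroup \<delta> L \<longleftrightarrow>
     0 < \<delta> \<and> 0 \<in> L \<and> (\<forall>x\<in>L. \<forall>y\<in>L. x - y \<in> L) \<and> (\<forall>x\<in>L. x \<noteq> 0 \<longrightarrow> \<delta> \<le> norm x)"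

lemma subgroup_add:
  assumes "separated_subgroup \<delta> L" "x \<in> L" "y \<in> L"
  shows "x + y \<in> L"
proof -
  have "0 - y \<in> L" using assms unfolding separated_subgroup_def by blast
  then have "x - (0 - y) \<in> L" using assms unfolding separated_subgroup_def by blast
  then show ?thesis by simp
qed

lemma subgroup_of_int:
  assumes L: "separated_subgroup \<delta> L" "x \<in> L"
  shows "of_int m *\<^sub>R x \<in> L"
proof (induction m rule: int_induct[where k = 0])
  case base
  then show ?case using L by (simp add: separated_subgroup_def)
next
  case (step1 i)
  then show ?case using subgroup_add[OF L(1) step1(2) L(2)] by (simp add: scaleR_left_distrib)
next
  case (step2 i)
  then show ?case using L by (simp add: scaleR_left_diff_distrib separated_subgroup_def)
qed

lemma subgroup_sum:
  assumes L: "separated_subgroup \<delta> L" and "\<And>i. i \<in> I \<Longrightarrow> f i \<in> L"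
  shows "sum f I \<in> L"
  using assms(2)
proof (induction I rule: infinite_finite_induct)
  case (insert i I)
  then show ?case using subgroup_add[OF L] by simp
qed (use L in \<open>auto simp: separated_subgroup_def\<close>)

text \<open>The infimum of the nonzero norms is positive, so some norm lies below \<open>4/3\<close>
  times it. Such a vector takes the place of a shortest one.\<close>

lemma almost_shortest_vector:
  assumes L: "separated_subgroup \<delta> L" and "L \<noteq> {0}"
  obtains u where "u \<in> L" "u \<noteq> 0" "\<And>y. y \<in> L \<Longrightarrow> y \<noteq> 0 \<Longrightarrow> norm u \<le> 4/3 * norm y"
proof -
  let ?X = "norm ` (L - {0})"
  have ne: "?X \<noteq> {}" using assms by (auto simp: separated_subgroup_def)
  have bdd: "bdd_below ?X" by (rule bdd_belowI[of _ 0]) auto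
  have "\<delta> \<le> Inf ?X" by (rule cInf_greatest[OF ne]) (use L in \<open>auto simp: separated_subgroup_def\<close>)
  then have "Inf ?X < 4/3 * Inf ?X" using L by (simp add: separated_subgroup_def)
  then obtain t where t: "t \<in> ?X" "t < 4/3 * Inf ?X"
    using cInf_lessD[OF ne] by blast
  then obtain u where u: "u \<in> L" "u \<noteq> 0" "t = norm u" by auto
  show ?thesis
  proof (rule that[OF u(1,2)])
    fix y assume "y \<in> L" "y \<noteq> 0"
    then have "Inf ?X \<le> norm y" by (intro cInf_lower[OF _ bdd]) auto
    then show "norm u \<le> 4/3 * norm y" using t u by linarith
  qed
qed

text \<open>The induction projects orthogonally to an almost shortest vector \<open>u\<close>: nonzero vectors of the
  projected group still have norm at least \<open>norm u / 2\<close>, and they lift with at most doubled norm.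
  The constant \<open>C\<close> must not depend on \<open>L\<close>; the \<open>b i\<close> may vanish when \<open>L\<close> has lower rank.\<close>

lemma reduced_basis:
  "\<exists>C\<ge>1. \<forall>(V :: 'a::euclidean_space set) L \<delta>.
     subspace V \<longrightarrow> dim V \<le> k \<longrightarrow> L \<subseteq> V \<longrightarrow> separated_subgroup \<delta> L \<longrightarrow>
     (\<exists>b. (\<forall>i<k. b i \<in> L) \<and> (\<forall>x\<in>L. \<exists>c :: nat \<Rightarrow> int.
        x = (\<Sum>i<k. of_int (c i) *\<^sub>R b i) \<and> (\<forall>i<k. \<bar>of_int (c i)\<bar> * norm (b i) \<le> C * norm x)))"
proof (induction k)
  case 0
  show ?case
  proof (rule exI[of _ 1], intro conjI allI impI exI ballI)
    fix V L :: "'a set" and x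
    assume "dim V \<le> 0" "L \<subseteq> V" "x \<in> L"
    then have "V \<subseteq> {0}" by (simp add: dim_eq_0)
    then show "x = (\<Sum>i<(0::nat). of_int (undefined i) *\<^sub>R undefined i)" using \<open>L \<subseteq> V\<close> \<open>x \<in> L\<close> by auto
  qed auto
next
  case (Suc k)
  then obtain C where C1: "C \<ge> 1" and C: "\<forall>(V :: 'a set) L \<delta>.
     subspace V \<longrightarrow> dim V \<le> k \<longrightarrow> L \<subseteq> V \<longrightarrow> separated_subgroup \<delta> L \<longrightarrow>
     (\<exists>b. (\<forall>i<k. b i \<in> L) \<and> (\<forall>x\<in>L. \<exists>c :: nat \<Rightarrow> int.
        x = (\<Sum>i<k. of_int (c i) *\<^sub>R b i) \<and> (\<forall>i<k. \<bar>of_int (c i)\<bar> * norm (b i) \<le> C * norm x)))"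
    by (elim exE conjE)
  \<comment> \<open>\<open>2 * C\<close> will bound the lifted coefficients and
    \<open>1 + k * (2 * C)\<close> the coefficient of the new vector \<open>u\<close>;
    \<open>D\<close> dominates both.\<close>
  define D where "D = 1 + 2 * (real k + 1) * C"
  have D: "1 \<le> D" "2 * C \<le> D" "1 + real k * (2 * C) \<le> D"
    using C1 by (auto simp: D_def algebra_simps)
  show ?case
  proof (intro exI[of _ D] conjI allI impI)
    show "D \<ge> 1" by fact
    fix V L :: "'a set" and \<delta>
    assume V: "subspace V" "dim V \<le> Suc k" and LV: "L \<subseteq> V" and L: "separated_subgroup \<delta> L"
    show "\<exists>b. (\<forall>i<Suc k. b i \<in> L) \<and> (\<forall>x\<in>L. \<exists>c :: nat \<Rightarrow> int.
        x = (\<Sum>i<Suc k. of_int (c i) *\<^sub>R b i) \<and> (\<forall>i<Suc k. \<bar>of_int (c i)\<bar> * norm (b i) \<le> D * norm x))"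
    proof (cases "L = {0}")
      case True
      then show ?thesis by (intro exI[of _ "\<lambda>_. 0"]) auto
    next
      case False
      obtain u where u: "u \<in> L" "u \<noteq> 0"
        and short: "\<And>y. y \<in> L \<Longrightarrow> y \<noteq> 0 \<Longrightarrow> norm u \<le> 4/3 * norm y"
        using almost_shortest_vector[OF L False] by blast
      \<comment> \<open>\<open>T x\<close> is the coefficient of \<open>x\<close> along
        \<open>u\<close>, and \<open>P\<close> the projection onto the orthogonal complement of
        \<open>u\<close>.\<close>
      define T where "T = (\<lambda>x. (x \<bullet> u) / (u \<bullet> u))"
      define P where "P = (\<lambda>x. x - T x *\<^sub>R u)"
      have uu: "u \<bullet> u > 0" using u by simp
      have Tadd: "T (x + y) = T x + T y" and Tsc: "T (a *\<^sub>R x) = a * T x"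
        and Tdiff: "T (x - y) = T x - T y" and Tu: "T u = 1" for x y a
        using uu by (auto simp: T_def inner_left_distrib inner_diff_left add_divide_distrib diff_divide_distrib)
      have linP: "linear P"
        by (rule linearI) (auto simp: P_def Tadd Tsc algebra_simps)
      have Pu: "P u = 0" by (simp add: P_def Tu)
      have Porth: "P x \<bullet> u = 0" for x
        using uu by (simp add: P_def T_def inner_diff_left)
      have pyth: "(norm x)\<^sup>2 = (norm (P x))\<^sup>2 + (T x)\<^sup>2 * (norm u)\<^sup>2" for x
      proof -
        have dec: "x = P x + T x *\<^sub>R u" by (simp add: P_def)
        have "(norm x)\<^sup>2 = (P x + T x *\<^sub>R u) \<bullet> (P x + T x *\<^sub>R u)"
          unfolding power2_norm_eq_inner by (rule arg_cong2[where f = inner, OF dec dec])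
        also have "\<dots> = (norm (P x))\<^sup>2 + (T x)\<^sup>2 * (norm u)\<^sup>2"
        proof -
          have "u \<bullet> P x = 0" using Porth[of x] by (simp only: inner_commute)
          then show ?thesis using Porth[of x] unfolding power2_norm_eq_inner
            by (simp only: inner_left_distrib inner_right_distrib inner_scaleR_left inner_scaleR_right
                power2_eq_square mult_zero_right mult.assoc add_0_left add_0_right)
        qed
        finally show ?thesis .
      qed
      have Ple: "norm (P x) \<le> norm x" for x
        by (rule power2_le_imp_le) (use pyth[of x] in auto)
      \<comment> \<open>Size reduction: subtracting the nearest integer multiple of \<open>u\<close>
        stays in \<open>L\<close> and does not change the projection.\<close>
      have red: "\<exists>z\<in>L. P z = P x \<and> \<bar>T z\<bar> \<le> 1/2 \<and> z = x - of_int (round (T x)) *\<^sub>R u" if "x \<in> L" for x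
      proof (intro bexI conjI)
        let ?z = "x - of_int (round (T x)) *\<^sub>R u"
        show "?z \<in> L" using L that subgroup_of_int[OF L u(1)] by (auto simp: separated_subgroup_def)
        show "P ?z = P x" using Pu by (simp add: linear_diff[OF linP] linear_scale[OF linP])
        show "\<bar>T ?z\<bar> \<le> 1/2"
          using of_int_round_abs_le[of "T x"] by (simp add: Tdiff Tsc Tu abs_minus_commute)
      qed simp
      \<comment> \<open>The reduced lift \<open>z\<close> is nonzero, so
        \<open>9/16 * (norm u)\<^sup>2 \<le> (norm z)\<^sup>2\<close>, while Pythagoras gives
        \<open>(norm z)\<^sup>2 \<le> (norm (P x))\<^sup>2 + 1/4 * (norm u)\<^sup>2\<close>. Hence
        \<open>(norm (P x))\<^sup>2\<close> is at least \<open>5/16 * (norm u)\<^sup>2\<close>,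
        which yields both estimates.\<close>
      have lift0: "\<exists>z\<in>L. P z = P x \<and> (norm u / 2)\<^sup>2 \<le> (norm (P x))\<^sup>2 \<and> (norm z)\<^sup>2 \<le> 2 * (norm (P x))\<^sup>2"
        if xL: "x \<in> L" and Px: "P x \<noteq> 0" for x
      proof -
        obtain z where z: "z \<in> L" "P z = P x" "\<bar>T z\<bar> \<le> 1/2" using red[OF xL] by blast
        have "z \<noteq> 0" using z Px by (auto simp: linear_0[OF linP])
        then have "norm u \<le> 4/3 * norm z" using short z by blast
        then have "(norm u)\<^sup>2 \<le> (4/3 * norm z)\<^sup>2" by (intro power_mono) auto
        then have 1: "9/16 * (norm u)\<^sup>2 \<le> (norm z)\<^sup>2" by (simp add: power_mult_distrib power_divide)
        have "(T z)\<^sup>2 \<le> (1/2)\<^sup>2" using z(3) by (metis abs_le_square_iff abs_numeral abs_divide abs_one)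
        then have "(T z)\<^sup>2 * (norm u)\<^sup>2 \<le> 1/4 * (norm u)\<^sup>2"
          by (intro mult_right_mono) (auto simp: power_divide)
        then have "(norm z)\<^sup>2 \<le> (norm (P x))\<^sup>2 + 1/4 * (norm u)\<^sup>2" using pyth[of z] z(2) by simp
        moreover have "0 \<le> (norm u)\<^sup>2" by simp
        moreover have "(norm u / 2)\<^sup>2 = 1/4 * (norm u)\<^sup>2" by (simp add: power_divide)
        ultimately have "(norm u / 2)\<^sup>2 \<le> (norm (P x))\<^sup>2" "(norm z)\<^sup>2 \<le> 2 * (norm (P x))\<^sup>2"
          using 1 by linarith+
        then show ?thesis using z by blast
      qed
      have lift: "\<exists>z\<in>L. P z = y \<and> norm z \<le> 2 * norm y" if y: "y \<in> P ` L" for y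
      proof (cases "y = 0")
        case True
        then show ?thesis using L by (intro bexI[of _ 0]) (auto simp: linear_0[OF linP] separated_subgroup_def)
      next
        case False
        from y obtain x where x: "x \<in> L" "y = P x" by blast
        then obtain z where z: "z \<in> L" "P z = y" "(norm z)\<^sup>2 \<le> 2 * (norm y)\<^sup>2" using lift0 False by blast
        have "(2 * norm y)\<^sup>2 = 4 * (norm y)\<^sup>2" by (simp add: power_mult_distrib)
        then have "(norm z)\<^sup>2 \<le> (2 * norm y)\<^sup>2" using z(3) zero_le_power2[of "norm y"] by linarith
        then show ?thesis using z power2_le_imp_le[of "norm z" "2 * norm y"] by auto
      qed
      have sep: "separated_subgroup (norm u / 2) (P ` L)"
        unfolding separated_subgroup_def
      proof (intro conjI ballI impI)
        show "0 < norm u / 2" using u by simp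
        show "0 \<in> P ` L" using L linear_0[OF linP] by (force simp: separated_subgroup_def)
        fix x y assume "x \<in> P ` L" "y \<in> P ` L"
        then show "x - y \<in> P ` L" using L
          by (auto simp: separated_subgroup_def linear_diff[OF linP, symmetric])
      next
        fix y assume "y \<in> P ` L" "y \<noteq> 0"
        then have "(norm u / 2)\<^sup>2 \<le> (norm y)\<^sup>2" using lift0 by blast
        then show "norm u / 2 \<le> norm y" by (rule power2_le_imp_le) simp
      qed
      \<comment> \<open>The projected group lives in \<open>W\<close>, whose dimension is smaller
        because \<open>u\<close> lies in \<open>V\<close> but not in \<open>W\<close>.\<close>
      define W where "W = V \<inter> {x. x \<bullet> u = 0}"
      have W: "subspace W"
        unfolding W_def by (intro subspace_inter V(1)) (auto simp: subspace_def inner_left_distrib)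
      have "u \<in> V" "u \<notin> W" using u LV uu by (auto simp: W_def)
      moreover have "W \<subseteq> V" by (auto simp: W_def)
      ultimately have "W \<subset> V" by blast
      then have "dim W < dim V" by (intro dim_psubset) (metis W V(1) span_eq_iff)
      then have dimW: "dim W \<le> k" using V(2) by simp
      have PLW: "P ` L \<subseteq> W"
      proof
        fix y assume "y \<in> P ` L"
        then obtain x where x: "x \<in> L" "y = P x" by blast
        have "P x \<in> V" unfolding P_def using x u LV V(1)
          by (intro subspace_diff subspace_scale) auto
        then show "y \<in> W" using x Porth by (auto simp: W_def)
      qed
      obtain e where e: "\<forall>i<k. e i \<in> P ` L" and ec: "\<And>x. x \<in> P ` L \<Longrightarrow> \<exists>c :: nat \<Rightarrow> int.
          x = (\<Sum>i<k. of_int (c i) *\<^sub>R e i) \<and> (\<forall>i<k. \<bar>of_int (c i)\<bar> * norm (e i) \<le> C * norm x)"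
        using C[rule_format, OF W dimW PLW sep] by blast
      have "\<forall>i. \<exists>z. i < k \<longrightarrow> z \<in> L \<and> P z = e i \<and> norm z \<le> 2 * norm (e i)" using lift e by blast
      then obtain b where b: "\<And>i. i < k \<Longrightarrow> b i \<in> L \<and> P (b i) = e i \<and> norm (b i) \<le> 2 * norm (e i)"
        by metis
      \<comment> \<open>The new basis consists of short lifts of the projected basis, with
        \<open>u\<close> in the last position.\<close>
      define b' where "b' = b(k := u)"
      have b'k: "b' k = u" and b'i: "\<And>i. i < k \<Longrightarrow> b' i = b i" by (auto simp: b'_def)
      show ?thesis
      proof (intro exI[of _ b'] conjI allI impI ballI)
        fix i assume "i < Suc k" then show "b' i \<in> L" using b u by (auto simp: b'_def)
      next
        fix x assume x: "x \<in> L"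
        obtain c :: "nat \<Rightarrow> int" where c: "P x = (\<Sum>i<k. of_int (c i) *\<^sub>R e i)"
          "\<And>i. i < k \<Longrightarrow> \<bar>of_int (c i)\<bar> * norm (e i) \<le> C * norm (P x)"
          using ec[of "P x"] x by blast
        define s where "s = (\<Sum>i<k. of_int (c i) *\<^sub>R b i)"
        define z where "z = x - s"
        have "s \<in> L" unfolding s_def using b by (intro subgroup_sum[OF L] subgroup_of_int[OF L]) auto
        then have z: "z \<in> L" using x L by (auto simp: z_def separated_subgroup_def)
        have "P s = P x" using b unfolding s_def c(1)
          by (simp add: linear_sum[OF linP] linear_scale[OF linP])
        then have Pz: "P z = 0" by (simp add: z_def linear_diff[OF linP])
        \<comment> \<open>As \<open>z\<close> projects to zero, its reduction \<open>w\<close> is a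
          multiple of \<open>u\<close> at most half as long. Near-minimality of \<open>u\<close>
          forces \<open>w = 0\<close>, so \<open>z\<close> is an integer multiple of
          \<open>u\<close>.\<close>
        obtain w where w: "w \<in> L" "P w = P z" "\<bar>T w\<bar> \<le> 1/2" "w = z - of_int (round (T z)) *\<^sub>R u"
          using red[OF z] by blast
        have "w = T w *\<^sub>R u" using w(2) Pz by (simp add: P_def)
        then have "norm w = \<bar>T w\<bar> * norm u" by (metis norm_scaleR)
        also have "\<dots> \<le> 1/2 * norm u" using w(3) by (intro mult_right_mono) auto
        finally have "w = 0" using short[OF w(1)] zero_less_norm_iff[of u, THEN iffD2, OF u(2)] by (cases "w = 0") linarith+
        then have zu: "z = of_int (round (T z)) *\<^sub>R u" using w by simp
        have bound: "\<bar>of_int (c i)\<bar> * norm (b i) \<le> 2 * C * norm x" if "i < k" for i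
        proof -
          have "\<bar>of_int (c i)\<bar> * norm (b i) \<le> \<bar>of_int (c i)\<bar> * (2 * norm (e i))"
            using b[OF that] by (intro mult_left_mono) auto
          also have "\<dots> \<le> 2 * (C * norm (P x))" using c(2)[OF that] by simp
          also have "\<dots> \<le> 2 * (C * norm x)" using Ple[of x] C1 by (intro mult_left_mono) auto
          finally show ?thesis by simp
        qed
        have "norm s \<le> (\<Sum>i<k. 2 * C * norm x)" unfolding s_def
          by (rule sum_norm_le) (use bound in auto)
        then have ns: "norm z \<le> (1 + real k * (2 * C)) * norm x"
          using norm_triangle_ineq4[of x s] by (simp add: z_def algebra_simps)
        let ?c = "c(k := round (T z))"
        show "\<exists>c :: nat \<Rightarrow> int. x = (\<Sum>i<Suc k. of_int (c i) *\<^sub>R b' i) \<and>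
               (\<forall>i<Suc k. \<bar>of_int (c i)\<bar> * norm (b' i) \<le> D * norm x)"
        proof (intro exI[of _ ?c] conjI allI impI)
          have "(\<Sum>i<Suc k. of_int (?c i) *\<^sub>R b' i) = s + z"
            using zu by (simp add: s_def b'_def)
          then show "x = (\<Sum>i<Suc k. of_int (?c i) *\<^sub>R b' i)" by (simp add: z_def)
          fix i assume "i < Suc k"
          then consider "i < k" | "i = k" by linarith
          then show "\<bar>of_int (?c i)\<bar> * norm (b' i) \<le> D * norm x"
          proof cases
            case 1
            then show ?thesis using bound[OF 1] mult_right_mono[OF D(2), of "norm x"] by (simp add: b'_def)
          next
            case 2
            have "\<bar>of_int (?c i)\<bar> * norm (b' i) = norm z" using 2 by (subst zu) (simp add: b'_def)
            then show ?thesis using ns mult_right_mono[OF D(3), of "norm x"] by simp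
          qed
        qed
      qed
    qed
  qed
qed

subsection \<open>Sparse hypergraphs\<close>

text \<open>For each of the \<open>q\<close> common colours, the values outside \<open>e\<close> are
  free. The product form avoids division.\<close>

lemma card_monochromatic:
  fixes V e :: "'v set"
  assumes "finite V" "e \<subseteq> V" "0 < q"
  shows "card {f \<in> V \<rightarrow>\<^sub>E {..<q}. \<exists>c<q. \<forall>v\<in>e. f v = c} * q ^ card e \<le> q * q ^ card V"
proof -
  let ?M = "{f \<in> V \<rightarrow>\<^sub>E {..<q}. \<exists>c<q. \<forall>v\<in>e. f v = c}"
  let ?F = "\<lambda>c. PiE V (\<lambda>v. if v \<in> e then {c} else {..<q})"
  have fin: "finite e" using assms finite_subset by blast
  have cF: "card (?F c) = q ^ (card V - card e)" for c
  proof -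
    have "card (?F c) = (\<Prod>v\<in>V. if v \<in> e then 1 else q)"
      using assms by (subst card_PiE) (auto intro!: prod.cong)
    also have "\<dots> = q ^ card (V - e)"
      using assms by (simp add: prod.If_cases Diff_eq)
    finally show ?thesis using assms fin by (simp add: card_Diff_subset)
  qed
  have "?M \<subseteq> (\<Union>c<q. ?F c)" by (fastforce simp: PiE_iff)
  then have "card ?M \<le> card (\<Union>c<q. ?F c)"
    using assms by (intro card_mono) (auto intro!: finite_PiE)
  also have "\<dots> \<le> (\<Sum>c<q. card (?F c))" by (rule card_UN_le) simp
  finally have "card ?M * q ^ card e \<le> q * q ^ (card V - card e) * q ^ card e" using cF by simp
  also have "\<dots> = q * q ^ card V"
    using card_mono[OF assms(1,2)] by (simp add: power_add[symmetric])
  finally show ?thesis .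
qed

text \<open>Averaging over all \<open>q\<close>-colourings of \<open>V\<close>, a colour class contains on average at most half as
  many edges as vertices; delete one vertex of each.\<close>

lemma large_independent_set:
  fixes V :: "'v set" and E :: "'v set set"
  assumes V: "finite V" and E: "\<And>e. e \<in> E \<Longrightarrow> e \<subseteq> V \<and> card e = r"
    and q: "0 < q" and r: "0 < r" and sparse: "2 * card E \<le> q ^ (r - 1) * card V"
  obtains S where "S \<subseteq> V" "\<And>e. e \<in> E \<Longrightarrow> \<not> e \<subseteq> S" "card V \<le> 2 * q * card S"
proof -
  let ?F = "V \<rightarrow>\<^sub>E {..<q}"
  define mono where "mono f = {e \<in> E. \<exists>c<q. \<forall>v\<in>e. f v = c}" for f :: "'v \<Rightarrow> nat"
  have finE: "finite E" using V E by (intro finite_subset[of E "Pow V"]) auto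
  have finF: "finite ?F" using V by (intro finite_PiE) auto
  have cF: "card ?F = q ^ card V" using V by (simp add: card_PiE)
  \<comment> \<open>A random colouring makes an edge monochromatic with probability at most q to the
    power 1 - r, so by \<open>sparse\<close> the expected number of such edges is at most half of
    \<open>card V\<close>.\<close>
  have "\<exists>f\<in>?F. 2 * card (mono f) \<le> card V"
  proof (rule ccontr)
    assume "\<not> ?thesis"
    then have "(\<Sum>f\<in>?F. card V) < (\<Sum>f\<in>?F. 2 * card (mono f))"
      using finF cF q by (intro sum_strict_mono) (auto simp: not_le)
    also have "(\<Sum>f\<in>?F. 2 * card (mono f)) = 2 * (\<Sum>f\<in>?F. \<Sum>e\<in>E. if \<exists>c<q. \<forall>v\<in>e. f v = c then 1 else 0)"
      by (simp add: sum_distrib_left mono_def finE sum.If_cases Int_def)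
    also have "(\<Sum>f\<in>?F. \<Sum>e\<in>E. if \<exists>c<q. \<forall>v\<in>e. f v = c then 1 else 0)
       = (\<Sum>e\<in>E. card {f \<in> ?F. \<exists>c<q. \<forall>v\<in>e. f v = c})"
      by (subst sum.swap) (simp add: finF sum.If_cases Int_def)
    finally have *: "q ^ card V * card V < 2 * (\<Sum>e\<in>E. card {f \<in> ?F. \<exists>c<q. \<forall>v\<in>e. f v = c})"
      by (simp add: cF)
    have qr: "q ^ r = q * q ^ (r - 1)" using r by (simp add: power_eq_if)
    have "q ^ card V * card V * q ^ r < 2 * (\<Sum>e\<in>E. card {f \<in> ?F. \<exists>c<q. \<forall>v\<in>e. f v = c}) * q ^ r"
      using * q by simp
    also have "\<dots> = 2 * (\<Sum>e\<in>E. card {f \<in> ?F. \<exists>c<q. \<forall>v\<in>e. f v = c} * q ^ r)"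
      by (simp add: sum_distrib_right)
    also have "\<dots> \<le> 2 * (\<Sum>e\<in>E. q * q ^ card V)"
      using card_monochromatic[OF V _ q] E by (intro mult_left_mono sum_mono) auto
    also have "\<dots> = q * q ^ card V * (2 * card E)" by simp
    also have "\<dots> \<le> q * q ^ card V * (q ^ (r - 1) * card V)"
      using sparse by (intro mult_left_mono) auto
    also have "\<dots> = q ^ card V * card V * q ^ r" by (simp add: qr)
    finally show False by simp
  qed
  then obtain f where f: "f \<in> ?F" "2 * card (mono f) \<le> card V" by blast
  define W where "W c = {v \<in> V. f v = c}" for c
  define H where "H c = {e \<in> E. e \<subseteq> W c}" for c
  have finW: "finite (W c)" and finH: "finite (H c)" for c using V finE by (auto simp: W_def H_def)
  have cV: "card V = (\<Sum>c<q. card (W c))"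
  proof -
    have "V = (\<Union>c<q. W c)" using f by (auto simp: W_def PiE_iff)
    then have "card V = card (\<Union>c<q. W c)" by simp
    also have "\<dots> = (\<Sum>c<q. card (W c))"
      using finW by (intro card_UN_disjoint) (auto simp: W_def)
    finally show ?thesis .
  qed
  have ne: "e \<noteq> {}" if "e \<in> E" for e using E[OF that] r by auto
  have "(\<Sum>c<q. card (H c)) = card (\<Union>c<q. H c)"
  proof (rule card_UN_disjoint[symmetric])
    show "\<forall>i\<in>{..<q}. \<forall>j\<in>{..<q}. i \<noteq> j \<longrightarrow> H i \<inter> H j = {}"
      using ne by (fastforce simp: H_def W_def)
  qed (use finH in auto)
  also have "\<dots> \<le> card (mono f)"
    using finE by (intro card_mono) (auto simp: H_def W_def mono_def)
  finally have cH: "(\<Sum>c<q. 2 * card (H c)) \<le> card V" using f(2) by (simp add: sum_distrib_left[symmetric])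
  \<comment> \<open>On average over the colours, a class has at least
    \<open>card V / (2 * q)\<close> more vertices than edges; the inequality is written additively
    because it is one of natural numbers.\<close>
  have "\<exists>c<q. card V + 2 * q * card (H c) \<le> 2 * q * card (W c)"
  proof (rule ccontr)
    assume "\<not> ?thesis"
    then have "(\<Sum>c<q. 2 * q * card (W c)) < (\<Sum>c<q. card V + 2 * q * card (H c))"
      using q by (intro sum_strict_mono) (auto simp: not_le)
    also have "\<dots> = q * card V + q * (\<Sum>c<q. 2 * card (H c))"
      by (simp add: sum.distrib sum_distrib_left mult_ac)
    also have "\<dots> \<le> q * card V + q * card V" using cH by simp
    also have "\<dots> = 2 * q * card V" by simp
    also have "\<dots> = (\<Sum>c<q. 2 * q * card (W c))" unfolding cV by (rule sum_distrib_left)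
    finally show False by simp
  qed
  then obtain c where c: "card V + 2 * q * card (H c) \<le> 2 * q * card (W c)" by blast
  define R where "R = (\<lambda>e. SOME v. v \<in> e) ` H c"
  have R: "card R \<le> card (H c)" unfolding R_def by (rule card_image_le[OF finH])
  have finR: "finite R" using finH by (simp add: R_def)
  show ?thesis
  proof (rule that[of "W c - R"])
    show "W c - R \<subseteq> V" by (auto simp: W_def)
    fix e assume e: "e \<in> E"
    show "\<not> e \<subseteq> W c - R"
    proof
      assume s: "e \<subseteq> W c - R"
      then have "(SOME v. v \<in> e) \<in> R" using e by (auto simp: R_def H_def)
      moreover have "(SOME v. v \<in> e) \<in> e" using ne[OF e] by (simp add: some_in_eq)
      ultimately show False using s by blast
    qed
  next
    have "card (W c) \<le> card (W c - R) + card (H c)"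
      using diff_card_le_card_Diff[OF finR, of "W c"] R by linarith
    then have "2 * q * card (W c) \<le> 2 * q * (card (W c - R) + card (H c))" by (rule mult_le_mono2)
    then show "card V \<le> 2 * q * card (W c - R)" using c by (simp add: distrib_left)
  qed
qed

subsection \<open>Factorization of degenerate tuples\<close>

definition int_lattice :: "(real ^ 'd::finite) set" where
  "int_lattice = {x. \<forall>c. x $ c \<in> \<int>}"

lemma int_lattice_add: "x \<in> int_lattice \<Longrightarrow> y \<in> int_lattice \<Longrightarrow> x + y \<in> int_lattice"
  and int_lattice_diff: "x \<in> int_lattice \<Longrightarrow> y \<in> int_lattice \<Longrightarrow> x - y \<in> int_lattice"
  and int_lattice_scale: "x \<in> int_lattice \<Longrightarrow> of_int m *\<^sub>R x \<in> int_lattice"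
  and int_lattice_0: "0 \<in> int_lattice"
  by (auto simp: int_lattice_def)

lemma int_lattice_sum: "(\<And>i. i \<in> I \<Longrightarrow> f i \<in> int_lattice) \<Longrightarrow> sum f I \<in> int_lattice"
  by (induction I rule: infinite_finite_induct) (auto simp: int_lattice_add int_lattice_0)

lemma int_lattice_norm_ge_1:
  assumes "x \<in> int_lattice" "x \<noteq> 0"
  shows "1 \<le> norm x"
proof -
  from assms(2) obtain c where "x $ c \<noteq> 0" by (auto simp: vec_eq_iff)
  then have "1 \<le> \<bar>x $ c\<bar>"
    using assms(1) Ints_nonzero_abs_ge1 by (auto simp: int_lattice_def)
  then show ?thesis using component_le_norm_cart[of x c] by linarith
qed

lemma separated_int_lattice:
  assumes "subspace V"
  shows "separated_subgroup 1 (V \<inter> int_lattice)"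
  using assms int_lattice_norm_ge_1
  by (auto simp: separated_subgroup_def subspace_diff subspace_0 int_lattice_0 int_lattice_diff)

text \<open>The ball lies in a cube with \<open>2 * \<lfloor>R\<rfloor> + 1\<close> integer values
  per coordinate.\<close>

lemma card_int_lattice_ball:
  assumes "0 \<le> R"
  shows "finite {x \<in> int_lattice :: (real ^ 'd::finite) set. norm x \<le> R}"
    and "real (card {x \<in> int_lattice :: (real ^ 'd::finite) set. norm x \<le> R}) \<le> (2 * R + 1) ^ CARD('d)"
proof -
  let ?B = "{x \<in> int_lattice :: (real ^ 'd::finite) set. norm x \<le> R}"
  let ?P = "(UNIV :: 'd set) \<rightarrow>\<^sub>E {-\<lfloor>R\<rfloor>..\<lfloor>R\<rfloor>}"
  let ?g = "\<lambda>f :: 'd \<Rightarrow> int. (\<chi> c. of_int (f c)) :: real ^ 'd"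
  have finP: "finite ?P" by (intro finite_PiE) auto
  have sub: "?B \<subseteq> ?g ` ?P"
  proof
    fix x assume x: "x \<in> ?B"
    have "\<bar>x $ c\<bar> \<le> R" for c using x component_le_norm_cart[of x c] by simp
    then have "\<lfloor>x $ c\<rfloor> \<in> {-\<lfloor>R\<rfloor>..\<lfloor>R\<rfloor>}" for c
    proof -
      have "x $ c = of_int \<lfloor>x $ c\<rfloor>" using x by (auto simp: int_lattice_def elim!: Ints_cases)
      then have "\<bar>of_int \<lfloor>x $ c\<rfloor>\<bar> \<le> R" using \<open>\<bar>x $ c\<bar> \<le> R\<close> by simp
      then have "of_int \<bar>\<lfloor>x $ c\<rfloor>\<bar> \<le> R" by simp
      then have "\<bar>\<lfloor>x $ c\<rfloor>\<bar> \<le> \<lfloor>R\<rfloor>" by (simp only: le_floor_iff)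
      then show ?thesis by auto
    qed
    then have f: "(\<lambda>c. \<lfloor>x $ c\<rfloor>) \<in> ?P" by (simp add: PiE_iff)
    have "?g (\<lambda>c. \<lfloor>x $ c\<rfloor>) = x"
      using x by (auto simp: vec_eq_iff int_lattice_def elim!: Ints_cases)
    then show "x \<in> ?g ` ?P" using imageI[OF f, of ?g] by simp
  qed
  show "finite ?B" using sub finP finite_subset by blast
  have "card ?B \<le> card ?P"
    using card_mono[OF _ sub] card_image_le[OF finP, of ?g] finP by (meson finite_imageI le_trans)
  also have "card ?P = nat (2 * \<lfloor>R\<rfloor> + 1) ^ CARD('d)"
    by (simp add: card_PiE algebra_simps)
  finally have "real (card ?B) \<le> real (nat (2 * \<lfloor>R\<rfloor> + 1)) ^ CARD('d)"
    by (metis of_nat_le_iff of_nat_power)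
  also have "\<dots> \<le> (2 * R + 1) ^ CARD('d)"
    using assms by (intro power_mono) auto
  finally show "real (card ?B) \<le> (2 * R + 1) ^ CARD('d)" .
qed

section \<open>Integral rank-one factorizations with sup norms of coefficient vectors\<close>

definition sup_abs :: "nat \<Rightarrow> (nat \<Rightarrow> int) \<Rightarrow> int" where
  "sup_abs r a = Max ((\<lambda>j. \<bar>a j\<bar>) ` {..<r})"

lemma sup_abs_ge: "j < r \<Longrightarrow> \<bar>a j\<bar> \<le> sup_abs r a"
  by (auto simp: sup_abs_def)

lemma sup_abs_attained:
  assumes "0 < r"
  shows "\<exists>j<r. \<bar>a j\<bar> = sup_abs r a"
proof -
  have "sup_abs r a \<in> (\<lambda>j. \<bar>a j\<bar>) ` {..<r}"
    unfolding sup_abs_def by (rule Max_in) (use assms in auto)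
  then show ?thesis by auto
qed

text \<open>The coefficient vectors are kept nonzero: a vanishing summand is written as the all-ones
  vector times the zero lattice vector.\<close>

lemma factor_tuple:
  fixes r k :: nat
  assumes "0 < r"
  shows "\<exists>C\<ge>1. \<forall>(V :: (real ^ 'd::finite) set) v R. subspace V \<longrightarrow> dim V \<le> k \<longrightarrow> 1 \<le> R \<longrightarrow>
     (\<forall>j<r. v j \<in> V \<inter> int_lattice \<and> norm (v j) \<le> R) \<longrightarrow>
     (\<exists>a b. (\<forall>i<k. b i \<in> int_lattice \<and> 1 \<le> sup_abs r (a i) \<and> of_int (sup_abs r (a i)) \<le> C * R
                 \<and> of_int (sup_abs r (a i)) * norm (b i) \<le> C * R)
          \<and> (\<forall>j<r. v j = (\<Sum>i<k. of_int (a i j) *\<^sub>R b i)))"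
proof -
  obtain C where C1: "C \<ge> 1" and C: "\<forall>(V :: (real ^ 'd) set) L \<delta>.
     subspace V \<longrightarrow> dim V \<le> k \<longrightarrow> L \<subseteq> V \<longrightarrow> separated_subgroup \<delta> L \<longrightarrow>
     (\<exists>b. (\<forall>i<k. b i \<in> L) \<and> (\<forall>x\<in>L. \<exists>c :: nat \<Rightarrow> int.
        x = (\<Sum>i<k. of_int (c i) *\<^sub>R b i) \<and> (\<forall>i<k. \<bar>of_int (c i)\<bar> * norm (b i) \<le> C * norm x)))"
    using reduced_basis[where 'a = "real ^ 'd"] by blast
  show ?thesis
  proof (intro exI[of _ C] conjI allI impI)
    show "1 \<le> C" by fact
    fix V :: "(real ^ 'd) set" and v :: "nat \<Rightarrow> real ^ 'd" and R :: real
    assume V: "subspace V" "dim V \<le> k" and R: "1 \<le> R"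
      and v: "\<forall>j<r. v j \<in> V \<inter> int_lattice \<and> norm (v j) \<le> R"
    obtain b where b: "\<And>i. i < k \<Longrightarrow> b i \<in> V \<inter> int_lattice"
      and bc: "\<forall>x\<in>V \<inter> int_lattice. \<exists>c :: nat \<Rightarrow> int.
        x = (\<Sum>i<k. of_int (c i) *\<^sub>R b i) \<and> (\<forall>i<k. \<bar>of_int (c i)\<bar> * norm (b i) \<le> C * norm x)"
      using C[rule_format, OF V _ separated_int_lattice[OF V(1)]] by blast
    \<comment> \<open>All \<open>v j\<close> are expanded in the same basis. For fixed
      \<open>i\<close> the numbers \<open>c j i\<close> form the coefficient vector
      \<open>a i\<close>, whose sup norm is attained at a single \<open>j\<close>, so the bound for
      that \<open>v j\<close> controls it.\<close>
    have "\<forall>j. \<exists>c :: nat \<Rightarrow> int. j < r \<longrightarrow>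
        v j = (\<Sum>i<k. of_int (c i) *\<^sub>R b i) \<and> (\<forall>i<k. \<bar>of_int (c i)\<bar> * norm (b i) \<le> C * norm (v j))"
      using bc v by blast
    then obtain c :: "nat \<Rightarrow> nat \<Rightarrow> int" where c: "\<forall>j. j < r \<longrightarrow>
        v j = (\<Sum>i<k. of_int (c j i) *\<^sub>R b i) \<and> (\<forall>i<k. \<bar>of_int (c j i)\<bar> * norm (b i) \<le> C * norm (v j))"
      by (rule choice[THEN exE])
    define triv where "triv i \<longleftrightarrow> b i = 0 \<or> (\<forall>j<r. c j i = 0)" for i
    define a where "a i j = (if triv i then 1 else c j i)" for i j
    define b' where "b' i = (if triv i then 0 else b i)" for i
    have CR: "1 \<le> C * R" using C1 R by (metis mult_mono' mult_1 zero_le_one)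
    show "\<exists>a b. (\<forall>i<k. b i \<in> int_lattice \<and> 1 \<le> sup_abs r (a i) \<and> of_int (sup_abs r (a i)) \<le> C * R
                 \<and> of_int (sup_abs r (a i)) * norm (b i) \<le> C * R)
          \<and> (\<forall>j<r. v j = (\<Sum>i<k. of_int (a i j) *\<^sub>R b i))"
    proof (intro exI[of _ a] exI[of _ b'] conjI allI impI)
      fix i assume i: "i < k"
      show "b' i \<in> int_lattice" using b[OF i] by (auto simp: b'_def int_lattice_0)
      obtain j where j: "j < r" "\<bar>a i j\<bar> = sup_abs r (a i)" using sup_abs_attained[OF assms] by blast
      have *: "1 \<le> sup_abs r (a i) \<and> of_int (sup_abs r (a i)) \<le> C * R
                 \<and> of_int (sup_abs r (a i)) * norm (b' i) \<le> C * R"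
      proof (cases "triv i")
        case True
        then show ?thesis using j(2) CR by (simp add: a_def b'_def)
      next
        case False
        then obtain j' where j': "j' < r" "c j' i \<noteq> 0" and bi: "b i \<noteq> 0" by (auto simp: triv_def)
        have "1 \<le> \<bar>a i j'\<bar>" using j' False by (simp add: a_def)
        then have 1: "1 \<le> sup_abs r (a i)" using sup_abs_ge[OF j'(1), of "a i"] by linarith
        have "\<bar>of_int (c j i)\<bar> * norm (b i) \<le> C * norm (v j)" using c j(1) i by blast
        also have "\<dots> \<le> C * R" using v j(1) C1 by (intro mult_left_mono) auto
        finally have 2: "of_int (sup_abs r (a i)) * norm (b i) \<le> C * R"
          using False by (simp add: j(2)[symmetric] a_def)
        \<comment> \<open>A nonzero integer vector has norm at least 1, so the product bound also
          bounds the coefficient vector alone.\<close>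
        have "1 \<le> norm (b i)" using b[OF i] bi by (intro int_lattice_norm_ge_1) auto
        then have "of_int (sup_abs r (a i)) * 1 \<le> of_int (sup_abs r (a i)) * norm (b i)"
          using 1 by (intro mult_left_mono) auto
        then have "of_int (sup_abs r (a i)) \<le> C * R" using 2 by linarith
        then show ?thesis using 1 2 False by (simp add: b'_def)
      qed
      from * show "1 \<le> sup_abs r (a i)" "of_int (sup_abs r (a i)) \<le> C * R"
        "of_int (sup_abs r (a i)) * norm (b' i) \<le> C * R" by auto
    next
      fix j assume j: "j < r"
      have "v j = (\<Sum>i<k. of_int (c j i) *\<^sub>R b i)" using c j by blast
      also have "\<dots> = (\<Sum>i<k. of_int (a i j) *\<^sub>R b' i)"
        using j by (intro sum.cong) (auto simp: a_def b'_def triv_def)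
      finally show "v j = (\<Sum>i<k. of_int (a i j) *\<^sub>R b' i)" .
    qed
  qed
qed

text \<open>Writing a tuple as \<open>\<Sum> a\<^sub>i b\<^sub>i\<close>, one may replace \<open>a\<^sub>i\<close> by \<open>a\<^sub>i - m\<^sub>i a\<^sub>q\<close> and \<open>b\<^sub>q\<close> by
  \<open>b\<^sub>q + \<Sum> m\<^sub>i b\<^sub>i\<close>. Removing this ambiguity is what leaves a single logarithm in the count for
  \<open>r = d\<close>; counting all factorizations would give its \<open>k\<close>-th power.\<close>

lemma reduce_factorization:
  fixes a :: "nat \<Rightarrow> nat \<Rightarrow> int" and b :: "nat \<Rightarrow> real ^ 'd::finite"
  assumes r: "0 < r" and k: "0 < k" and N: "0 \<le> N"
    and ab: "\<And>i. i < k \<Longrightarrow> b i \<in> int_lattice \<and> 1 \<le> sup_abs r (a i) \<and> of_int (sup_abs r (a i)) \<le> N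
                 \<and> of_int (sup_abs r (a i)) * norm (b i) \<le> N"
  obtains q p a' b' where "q < k" "p < r" "1 \<le> sup_abs r (a' q)"
    "\<And>i. i < k \<Longrightarrow> b' i \<in> int_lattice"
    "\<And>i. i < k \<Longrightarrow> of_int (sup_abs r (a' i)) \<le> 3 * real k * N"
    "\<And>i. i < k \<Longrightarrow> \<bar>a' i p\<bar> \<le> sup_abs r (a' q)"
    "\<And>i. i < k \<Longrightarrow> of_int (max (sup_abs r (a' i)) (sup_abs r (a' q))) * norm (b' i) \<le> 3 * real k * N"
    "\<And>j. (\<Sum>i<k. of_int (a' i j) *\<^sub>R b' i) = (\<Sum>i<k. of_int (a i j) *\<^sub>R b i)"
proof -
  obtain q where q: "q < k" and qmin: "\<And>i. i < k \<Longrightarrow> sup_abs r (a q) \<le> sup_abs r (a i)"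
    using ex_min_if_finite[of "{..<k}"] arg_min_if_finite[of "{..<k}" "\<lambda>i. sup_abs r (a i)"] k
    by (metis finite_lessThan lessThan_empty_iff lessThan_iff neq0_conv not_le)
  obtain p where p: "p < r" "\<bar>a q p\<bar> = sup_abs r (a q)" using sup_abs_attained[OF r] by blast
  define A where "A = sup_abs r (a q)"
  have A: "1 \<le> A" "\<bar>a q p\<bar> = A" using ab[OF q] p by (auto simp: A_def)
  \<comment> \<open>Integer quotients in the pivot coordinate \<open>p\<close>: each
    \<open>a' i p\<close> with \<open>i\<close> other than \<open>q\<close> becomes a remainder
    modulo \<open>a q p\<close>. Setting \<open>m q = 0\<close> keeps the pivot vector
    itself.\<close>
  define m where "m i = (if i = q then 0 else a i p div a q p)" for i
  define a' where "a' i j = a i j - m i * a q j" for i j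
  define b' where "b' i = (if i = q then b q + (\<Sum>i<k. of_int (m i) *\<^sub>R b i) else b i)" for i
  have a'q: "a' q = a q" by (auto simp: a'_def m_def)
  have red: "\<bar>a' i p\<bar> \<le> A" for i
  proof (cases "i = q")
    case True
    then show ?thesis using A a'q by simp
  next
    case False
    have "a' i p = a i p mod a q p" using False by (simp add: a'_def m_def minus_div_mult_eq_mod)
    then show ?thesis using A abs_mod_less[of "a q p" "a i p"] by (cases "a q p = 0") auto
  qed
  \<comment> \<open>Minimality of \<open>a q\<close> is what bounds the quotients, and thereby the
    vectors \<open>m i\<close> times \<open>b i\<close> that are added to
    \<open>b q\<close>.\<close>
  have mA: "\<bar>m i\<bar> * A \<le> 2 * sup_abs r (a i)" if i: "i < k" for i
  proof -
    have "\<bar>m i\<bar> * A = \<bar>m i * a q p\<bar>" using A by (simp add: abs_mult)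
    also have "m i * a q p = a i p - a' i p" by (simp add: a'_def)
    also have "\<bar>\<dots>\<bar> \<le> \<bar>a i p\<bar> + A" using red[of i] by linarith
    also have "\<dots> \<le> 2 * sup_abs r (a i)" using sup_abs_ge[OF p(1), of "a i"] qmin[OF i] by (simp add: A_def)
    finally show ?thesis .
  qed
  have sup: "sup_abs r (a' i) \<le> 3 * sup_abs r (a i)" if i: "i < k" for i
  proof -
    obtain j where j: "j < r" "\<bar>a' i j\<bar> = sup_abs r (a' i)" using sup_abs_attained[OF r] by blast
    have "\<bar>m i * a q j\<bar> \<le> \<bar>m i\<bar> * A"
      using sup_abs_ge[OF j(1), of "a q"] unfolding abs_mult A_def by (intro mult_left_mono) auto
    then have "\<bar>a' i j\<bar> \<le> \<bar>a i j\<bar> + \<bar>m i\<bar> * A" unfolding a'_def by linarith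
    then show ?thesis using j(2) sup_abs_ge[OF j(1), of "a i"] mA[OF i] by linarith
  qed
  \<comment> \<open>The bound for \<open>b' q\<close> adds up to \<open>N + 2 * k * N\<close>, which
    this turns into \<open>3 * k * N\<close>.\<close>
  have kN: "N \<le> real k * N" using k N mult_right_mono[of 1 "real k" N] by (simp add: mult.commute)
  have mb: "of_int A * norm (of_int (m i) *\<^sub>R b i) \<le> 2 * N" if i: "i < k" for i
  proof -
    have "of_int A * norm (of_int (m i) *\<^sub>R b i) = of_int (\<bar>m i\<bar> * A) * norm (b i)" by simp
    also have "\<dots> \<le> of_int (2 * sup_abs r (a i)) * norm (b i)"
      using mA[OF i] by (intro mult_right_mono) (simp_all only: of_int_le_iff norm_ge_zero)
    also have "\<dots> \<le> 2 * N" using ab[OF i] by simp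
    finally show ?thesis .
  qed
  show ?thesis
  proof (rule that[of q p a' b'])
    show "q < k" "p < r" by fact+
    show "1 \<le> sup_abs r (a' q)" using A by (simp add: a'q A_def)
    fix i assume i: "i < k"
    show "b' i \<in> int_lattice"
      using ab i unfolding b'_def by (auto intro!: int_lattice_add int_lattice_sum int_lattice_scale)
    have "real_of_int (sup_abs r (a' i)) \<le> of_int (3 * sup_abs r (a i))"
      using sup[OF i] by (simp only: of_int_le_iff)
    then have sup': "real_of_int (sup_abs r (a' i)) \<le> 3 * of_int (sup_abs r (a i))" by simp
    then show "of_int (sup_abs r (a' i)) \<le> 3 * real k * N" using ab[OF i] kN by linarith
    show "\<bar>a' i p\<bar> \<le> sup_abs r (a' q)" using red by (simp add: a'q A_def)
    show "of_int (max (sup_abs r (a' i)) (sup_abs r (a' q))) * norm (b' i) \<le> 3 * real k * N"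
    proof (cases "i = q")
      case True
      have "of_int A * norm (b' i) \<le> of_int A * (norm (b q) + (\<Sum>i<k. norm (of_int (m i) *\<^sub>R b i)))"
        using A True unfolding b'_def
        by (intro mult_left_mono) (auto intro!: order.trans[OF norm_triangle_ineq] norm_sum simp del: norm_scaleR)
      also have "\<dots> = of_int A * norm (b q) + (\<Sum>i<k. of_int A * norm (of_int (m i) *\<^sub>R b i))"
        by (simp add: distrib_left sum_distrib_left)
      also have "\<dots> \<le> N + (\<Sum>i<k. 2 * N)"
        using ab[OF q] mb by (intro add_mono sum_mono) (auto simp: A_def)
      also have "\<dots> \<le> 3 * real k * N" using kN by (simp add: algebra_simps)
      finally show ?thesis using True by (simp add: a'q A_def)
    next
      case False
      have "max (sup_abs r (a' i)) (sup_abs r (a' q)) \<le> 3 * sup_abs r (a i)"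
        using sup[OF i] qmin[OF i] ab[OF i] by (simp add: a'q)
      then have "real_of_int (max (sup_abs r (a' i)) (sup_abs r (a' q))) * norm (b' i)
          \<le> of_int (3 * sup_abs r (a i)) * norm (b' i)"
        by (intro mult_right_mono) (simp_all only: of_int_le_iff norm_ge_zero)
      also have "\<dots> \<le> 3 * N" using ab[OF i] False by (simp add: b'_def)
      finally show ?thesis using kN by linarith
    qed
  next
    fix j
    have "(\<Sum>i<k. of_int (a' i j) *\<^sub>R b' i)
        = (\<Sum>i<k. of_int (a' i j) *\<^sub>R b i + (if i = q then of_int (a q j) *\<^sub>R (\<Sum>i<k. of_int (m i) *\<^sub>R b i) else 0))"
      by (intro sum.cong) (auto simp: b'_def a'q scaleR_right_distrib)
    also have "\<dots> = (\<Sum>i<k. of_int (a' i j) *\<^sub>R b i + of_int (a q j) *\<^sub>R of_int (m i) *\<^sub>R b i)"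
      using q by (simp add: sum.distrib scaleR_sum_right)
    also have "\<dots> = (\<Sum>i<k. of_int (a i j) *\<^sub>R b i)"
      by (intro sum.cong) (auto simp: a'_def algebra_simps)
    finally show "(\<Sum>i<k. of_int (a' i j) *\<^sub>R b' i) = (\<Sum>i<k. of_int (a i j) *\<^sub>R b i)" .
  qed
qed

subsection \<open>Counting degenerate tuples\<close>

text \<open>Candidates for one summand with coefficient vector at scale \<open>2 ^ l\<close>; the
  radius \<open>R / 2 ^ l\<close> encodes the product bound. Coordinate \<open>p\<close> only has
  scale \<open>2 ^ j\<close>, being reduced modulo the pivot vector. The case \<open>l = j\<close>
  serves the pivot itself.\<close>

definition dyadic_block ::
    "nat \<Rightarrow> nat \<Rightarrow> nat \<Rightarrow> nat \<Rightarrow> real \<Rightarrow> ((nat \<Rightarrow> int) \<times> (real ^ 'd::finite)) set" where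
  "dyadic_block r p j l R =
     (\<Pi>\<^sub>E i\<in>{..<r}. if i = p then {-(2 ^ Suc j)..2 ^ Suc j} else {-(2 ^ Suc l)..2 ^ Suc l})
       \<times> {x \<in> int_lattice. norm x \<le> R / 2 ^ l}"

text \<open>The rows of the sum of the rank-one matrices; the restriction makes the tuple
  extensional, as in \<open>degenerate_tuples\<close>.\<close>

definition tuple_of :: "nat \<Rightarrow> nat \<Rightarrow> (nat \<Rightarrow> (nat \<Rightarrow> int) \<times> (real ^ 'd::finite)) \<Rightarrow> nat \<Rightarrow> real ^ 'd" where
  "tuple_of r k t = (\<lambda>j\<in>{..<r}. \<Sum>i<k. of_int (fst (t i) j) *\<^sub>R snd (t i))"

text \<open>Tuples are ordered and may repeat points, so their number bounds that of the degenerate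
  \<open>r\<close>-element sets from above.\<close>

definition degenerate_tuples :: "nat \<Rightarrow> nat \<Rightarrow> (real ^ 'd::finite) set \<Rightarrow> (nat \<Rightarrow> real ^ 'd) set" where
  "degenerate_tuples r k X = {v \<in> {..<r} \<rightarrow>\<^sub>E X. \<exists>V. subspace V \<and> dim V = k \<and> v ` {..<r} \<subseteq> V}"

text \<open>Coordinate \<open>p\<close> has at most \<open>5 * 2 ^ j\<close> values and every other
  one at most \<open>5 * 2 ^ l\<close>. Since \<open>R / 2 ^ l\<close> is at least 1, the ball count
  \<open>2 * x + 1\<close> is at most \<open>3 * x\<close> per coordinate.\<close>

lemma card_dyadic_block:
  assumes p: "p < r" and R: "2 ^ l \<le> R"
  shows "finite (dyadic_block r p j l R :: ((nat \<Rightarrow> int) \<times> (real ^ 'd::finite)) set)"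
    and "real (card (dyadic_block r p j l R :: ((nat \<Rightarrow> int) \<times> (real ^ 'd)) set))
      \<le> 5 ^ r * (3 * R) ^ CARD('d) * (2 ^ j * 2 ^ (l * (r - 1)) / 2 ^ (l * CARD('d)))"
proof -
  let ?I = "\<lambda>m :: nat. {-(2 ^ Suc m)..2 ^ Suc m :: int}"
  let ?P = "\<Pi>\<^sub>E i\<in>{..<r}. if i = p then ?I j else ?I l"
  let ?B = "{x \<in> int_lattice :: (real ^ 'd) set. norm x \<le> R / 2 ^ l}"
  have R1: "1 \<le> R / 2 ^ l" using R by (simp add: field_simps)
  then have R0: "0 \<le> R / 2 ^ l" by linarith
  have finP: "finite ?P" by (intro finite_PiE) auto
  have finB: "finite ?B" by (rule card_int_lattice_ball(1)[OF R0])
  show "finite (dyadic_block r p j l R :: ((nat \<Rightarrow> int) \<times> (real ^ 'd)) set)"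
    unfolding dyadic_block_def using finP finB by blast
  have cI: "real (card (?I m)) \<le> 5 * 2 ^ m" for m
  proof -
    have "card (?I m) = nat (4 * 2 ^ m + 1)" by simp
    also have "real \<dots> = 4 * 2 ^ m + 1" by simp
    also have "\<dots> \<le> 5 * 2 ^ m" by simp
    finally show ?thesis .
  qed
  have "card ?P = (\<Prod>i<r. if i = p then card (?I j) else card (?I l))"
    by (subst card_PiE) (auto intro!: prod.cong)
  also have "\<dots> = card (?I j) * card (?I l) ^ (r - 1)"
    using p by (subst prod.remove[of _ p]) (auto simp: card_Diff_singleton)
  finally have "real (card ?P) = real (card (?I j)) * real (card (?I l)) ^ (r - 1)" by (simp only: of_nat_mult of_nat_power)
  also have "\<dots> \<le> (5 * 2 ^ j) * (5 * 2 ^ l) ^ (r - 1)"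
    using cI by (intro mult_mono power_mono) auto
  also have "\<dots> = 5 ^ r * (2 ^ j * 2 ^ (l * (r - 1)))"
    using p by (simp add: power_mult_distrib power_mult power_eq_if[of _ r])
  finally have cP: "real (card ?P) \<le> 5 ^ r * (2 ^ j * 2 ^ (l * (r - 1)))" .
  have "real (card ?B) \<le> (2 * (R / 2 ^ l) + 1) ^ CARD('d)" by (rule card_int_lattice_ball(2)[OF R0])
  also have "\<dots> \<le> (3 * (R / 2 ^ l)) ^ CARD('d)" using R0 R1 by (intro power_mono; linarith)
  also have "\<dots> = (3 * R) ^ CARD('d) / 2 ^ (l * CARD('d))"
    by (simp add: power_divide power_mult)
  finally have cB: "real (card ?B) \<le> (3 * R) ^ CARD('d) / 2 ^ (l * CARD('d))" .
  have "real (card (dyadic_block r p j l R :: ((nat \<Rightarrow> int) \<times> (real ^ 'd)) set)) = real (card ?P) * real (card ?B)"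
    by (simp only: dyadic_block_def card_cartesian_product of_nat_mult)
  also have "\<dots> \<le> (5 ^ r * (2 ^ j * 2 ^ (l * (r - 1)))) * ((3 * R) ^ CARD('d) / 2 ^ (l * CARD('d)))"
    using cP cB by (intro mult_mono) auto
  finally show "real (card (dyadic_block r p j l R :: ((nat \<Rightarrow> int) \<times> (real ^ 'd)) set))
      \<le> 5 ^ r * (3 * R) ^ CARD('d) * (2 ^ j * 2 ^ (l * (r - 1)) / 2 ^ (l * CARD('d)))"
    by (simp add: mult_ac)
qed

lemma sum_dyadic_tail: "(\<Sum>l\<in>{j..J}. 2 ^ j / 2 ^ l :: real) \<le> 2"
proof -
  \<comment> \<open>Indexing by the length \<open>m\<close> treats the empty range
    \<open>j > J\<close> as the case \<open>m = 0\<close>.\<close>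
  have "(\<Sum>l\<in>{j..<j + m}. 2 ^ j / 2 ^ l :: real) = 2 - 2 / 2 ^ m" for m
    by (induction m) (auto simp: power_add field_simps)
  from this[of "Suc J - j"] have *: "(\<Sum>l\<in>{j..<j + (Suc J - j)}. 2 ^ j / 2 ^ l :: real) \<le> 2" by simp
  have "{j..J} = {j..<j + (Suc J - j)}" by auto
  then show ?thesis using * by simp
qed

text \<open>As \<open>r\<close> is at most the dimension, level \<open>l\<close> contributes a
  factor of at most \<open>2 ^ j / 2 ^ l\<close>, a geometric series. The reduced coordinate
  supplies \<open>2 ^ j\<close> in place of \<open>2 ^ l\<close>; without it all levels would count
  equally when \<open>r\<close> is the dimension.\<close>

lemma card_dyadic_union:
  assumes p: "p < r" and R: "2 ^ J \<le> R" and rd: "r \<le> CARD('d::finite)"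
  shows "finite (\<Union>l\<in>{j..J}. dyadic_block r p j l R :: ((nat \<Rightarrow> int) \<times> (real ^ 'd)) set)"
    and "real (card (\<Union>l\<in>{j..J}. dyadic_block r p j l R :: ((nat \<Rightarrow> int) \<times> (real ^ 'd)) set))
      \<le> 2 * (5 ^ r * (3 * R) ^ CARD('d))"
proof -
  have Rl: "2 ^ l \<le> R" if "l \<le> J" for l
    using power_increasing[OF that, of "2::real"] R by linarith
  show "finite (\<Union>l\<in>{j..J}. dyadic_block r p j l R :: ((nat \<Rightarrow> int) \<times> (real ^ 'd)) set)"
    using card_dyadic_block(1)[OF p Rl] by auto
  have R0: "0 \<le> R" using Rl[of 0] by simp
  have "real (card (\<Union>l\<in>{j..J}. dyadic_block r p j l R :: ((nat \<Rightarrow> int) \<times> (real ^ 'd)) set))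
      \<le> (\<Sum>l\<in>{j..J}. real (card (dyadic_block r p j l R :: ((nat \<Rightarrow> int) \<times> (real ^ 'd)) set)))"
    unfolding of_nat_sum[symmetric] of_nat_le_iff by (rule card_UN_le) simp
  also have "\<dots> \<le> (\<Sum>l\<in>{j..J}. 5 ^ r * (3 * R) ^ CARD('d) * (2 ^ j / 2 ^ l))"
  proof (rule sum_mono)
    fix l assume l: "l \<in> {j..J}"
    have "2 ^ (l * (r - 1)) * 2 ^ l = (2 :: real) ^ (l * r)"
      using p by (simp add: power_add[symmetric] algebra_simps)
    also have "\<dots> \<le> 2 ^ (l * CARD('d))" using rd by (intro power_increasing) auto
    finally have "2 ^ (l * (r - 1)) / 2 ^ (l * CARD('d)) \<le> (1 :: real) / 2 ^ l"
      by (simp add: field_simps)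
    then have "2 ^ j * (2 ^ (l * (r - 1)) / 2 ^ (l * CARD('d))) \<le> (2 :: real) ^ j * (1 / 2 ^ l)"
      by (intro mult_left_mono) auto
    then have "5 ^ r * (3 * R) ^ CARD('d) * (2 ^ j * 2 ^ (l * (r - 1)) / 2 ^ (l * CARD('d)))
        \<le> 5 ^ r * (3 * R) ^ CARD('d) * (2 ^ j / 2 ^ l)"
      using R0 by (intro mult_left_mono) auto
    then show "real (card (dyadic_block r p j l R :: ((nat \<Rightarrow> int) \<times> (real ^ 'd)) set))
        \<le> 5 ^ r * (3 * R) ^ CARD('d) * (2 ^ j / 2 ^ l)"
      using card_dyadic_block(2)[OF p Rl, of l j, where 'd = 'd] l by simp
  qed
  also have "\<dots> = 5 ^ r * (3 * R) ^ CARD('d) * (\<Sum>l\<in>{j..J}. 2 ^ j / 2 ^ l)"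
    by (rule sum_distrib_left[symmetric])
  also have "\<dots> \<le> 5 ^ r * (3 * R) ^ CARD('d) * 2"
    using sum_dyadic_tail R0 by (intro mult_left_mono) auto
  finally show "real (card (\<Union>l\<in>{j..J}. dyadic_block r p j l R :: ((nat \<Rightarrow> int) \<times> (real ^ 'd)) set))
      \<le> 2 * (5 ^ r * (3 * R) ^ CARD('d))" by simp
qed

lemma ex_dyadic:
  fixes x :: int
  assumes "1 \<le> x"
  obtains l where "2 ^ l \<le> x" "x \<le> 2 ^ Suc l"
proof -
  define l where "l = floor_log (nat x)"
  have "2 ^ l \<le> nat x" "nat x < 2 ^ Suc l"
    using assms floor_log_exp2_le[of "nat x"] floor_log_exp2_gt[of "nat x"] by (auto simp: l_def)
  then have "int (2 ^ l) \<le> int (nat x)" "int (nat x) \<le> int (2 ^ Suc l)"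
    unfolding of_nat_le_iff by linarith+
  then have "2 ^ l \<le> x" "x \<le> 2 ^ Suc l" using assms by auto
  then show ?thesis by (rule that)
qed

text \<open>The index \<open>q\<close> marks the coefficient vector of least norm, which lies between \<open>2 ^ j\<close> and
  \<open>2 ^ Suc j\<close>, and \<open>p\<close> the coordinate modulo which the other coefficient vectors are reduced.\<close>

lemma degenerate_tuples_cover:
  assumes r: "0 < r" and k: "0 < k"
  shows "\<exists>C\<ge>1. \<forall>X \<rho> J. 1 \<le> \<rho> \<longrightarrow> X \<subseteq> int_lattice \<longrightarrow> (\<forall>x\<in>X. norm x \<le> \<rho>) \<longrightarrow>
     (\<forall>l. 2 ^ l \<le> C * \<rho> \<longrightarrow> l \<le> J) \<longrightarrow>
     degenerate_tuples r k (X :: (real ^ 'd::finite) set) \<subseteq> (\<Union>q<k. \<Union>p<r. \<Union>j\<le>J. tuple_of r k `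
       (\<Pi>\<^sub>E i\<in>{..<k}. if i = q then dyadic_block r p j j (C * \<rho>)
                   else \<Union>l\<in>{j..J}. dyadic_block r p j l (C * \<rho>)))"
proof -
  obtain C where C1: "C \<ge> 1" and C: "\<forall>(V :: (real ^ 'd) set) v R. subspace V \<longrightarrow> dim V \<le> k \<longrightarrow> 1 \<le> R \<longrightarrow>
     (\<forall>j<r. v j \<in> V \<inter> int_lattice \<and> norm (v j) \<le> R) \<longrightarrow>
     (\<exists>a b. (\<forall>i<k. b i \<in> int_lattice \<and> 1 \<le> sup_abs r (a i) \<and> of_int (sup_abs r (a i)) \<le> C * R
                 \<and> of_int (sup_abs r (a i)) * norm (b i) \<le> C * R)
          \<and> (\<forall>j<r. v j = (\<Sum>i<k. of_int (a i j) *\<^sub>R b i)))"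
    using factor_tuple[OF r] by blast
  \<comment> \<open>\<open>C\<close> comes from the factorization and \<open>3 * k\<close> from its
    reduction.\<close>
  define D where "D = 3 * real k * C"
  have "1 \<le> 3 * real k" using k by simp
  then have D1: "1 \<le> D" using C1 mult_mono[of 1 "3 * real k" 1 C] by (simp add: D_def)
  show ?thesis
  proof (intro exI[of _ D] conjI allI impI subsetI)
    show "1 \<le> D" by fact
    fix X :: "(real ^ 'd) set" and \<rho> :: real and J and v
    assume \<rho>: "1 \<le> \<rho>" and X: "X \<subseteq> int_lattice" "\<forall>x\<in>X. norm x \<le> \<rho>"
      and J: "\<forall>l. 2 ^ l \<le> D * \<rho> \<longrightarrow> l \<le> J" and "v \<in> degenerate_tuples r k X"
    then obtain V where v: "v \<in> {..<r} \<rightarrow>\<^sub>E X" and V: "subspace V" "dim V = k" "v ` {..<r} \<subseteq> V"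
      by (auto simp: degenerate_tuples_def)
    have "\<forall>j<r. v j \<in> V \<inter> int_lattice \<and> norm (v j) \<le> \<rho>" using v V(3) X by (auto simp: PiE_iff)
    then obtain a b where ab: "\<And>i. i < k \<Longrightarrow> b i \<in> int_lattice \<and> 1 \<le> sup_abs r (a i) \<and> of_int (sup_abs r (a i)) \<le> C * \<rho>
                 \<and> of_int (sup_abs r (a i)) * norm (b i) \<le> C * \<rho>"
        and vab: "\<And>j. j < r \<Longrightarrow> v j = (\<Sum>i<k. of_int (a i j) *\<^sub>R b i)"
      using C[rule_format, of V \<rho> v] V \<rho> by auto
    have C\<rho>: "0 \<le> C * \<rho>" using C1 \<rho> by simp
    obtain q p a' b' where q: "q < k" and p: "p < r" and aq: "1 \<le> sup_abs r (a' q)"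
      and b': "\<And>i. i < k \<Longrightarrow> b' i \<in> int_lattice"
      and a'D: "\<And>i. i < k \<Longrightarrow> of_int (sup_abs r (a' i)) \<le> D * \<rho>"
      and ap: "\<And>i. i < k \<Longrightarrow> \<bar>a' i p\<bar> \<le> sup_abs r (a' q)"
      and ab': "\<And>i. i < k \<Longrightarrow> of_int (max (sup_abs r (a' i)) (sup_abs r (a' q))) * norm (b' i) \<le> D * \<rho>"
      and eq: "\<And>j. (\<Sum>i<k. of_int (a' i j) *\<^sub>R b' i) = (\<Sum>i<k. of_int (a i j) *\<^sub>R b i)"
      by (rule reduce_factorization[OF r k C\<rho> ab]) (auto simp: D_def mult.assoc)
    obtain j where j: "2 ^ j \<le> sup_abs r (a' q)" "sup_abs r (a' q) \<le> 2 ^ Suc j" using ex_dyadic[OF aq] .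
    have norm_le: "norm (b' i) \<le> D * \<rho> / 2 ^ l"
      if "i < k" "2 ^ l \<le> max (sup_abs r (a' i)) (sup_abs r (a' q))" for i l
    proof -
      have "real_of_int (2 ^ l) \<le> of_int (max (sup_abs r (a' i)) (sup_abs r (a' q)))"
        using that(2) by (simp only: of_int_le_iff)
      then have "real_of_int (2 ^ l) * norm (b' i) \<le> D * \<rho>"
        using ab'[OF that(1)] by (meson mult_right_mono norm_ge_zero order_trans)
      then show ?thesis by (simp add: field_simps)
    qed
    have le_J: "l \<le> J" if "i < k" "2 ^ l \<le> max (sup_abs r (a' i)) (sup_abs r (a' q))" for i l
    proof -
      have "real_of_int (2 ^ l) \<le> of_int (max (sup_abs r (a' i)) (sup_abs r (a' q)))"
        using that(2) by (simp only: of_int_le_iff)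
      also have "\<dots> \<le> D * \<rho>" using a'D[OF that(1)] a'D[OF q] by (simp add: max_def)
      finally show ?thesis using J by simp
    qed
    have jJ: "j \<le> J" using le_J[OF q, of j] j by simp
    \<comment> \<open>\<open>restrict\<close> is needed because the coefficient vectors of
      \<open>dyadic_block\<close> are extensional functions.\<close>
    define t where "t = (\<lambda>i\<in>{..<k}. (restrict (a' i) {..<r}, b' i))"
    let ?F = "\<lambda>i. if i = q then dyadic_block r p j j (D * \<rho>)
                   else \<Union>l\<in>{j..J}. dyadic_block r p j l (D * \<rho>)"
    have block: "(restrict (a' i) {..<r}, b' i) \<in> dyadic_block r p j l (D * \<rho>)"
      if i: "i < k" and l: "2 ^ l \<le> max (sup_abs r (a' i)) (sup_abs r (a' q))" "sup_abs r (a' i) \<le> 2 ^ Suc l" for i l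
    proof -
      have "\<bar>a' i m\<bar> \<le> 2 ^ Suc l" if "m < r" for m using sup_abs_ge[OF that, of "a' i"] l(2) by linarith
      then have "a' i m \<in> {-(2 ^ Suc l)..2 ^ Suc l}" if "m < r" for m
        using that unfolding abs_le_iff atLeastAtMost_iff by (metis minus_le_iff)
      moreover have "\<bar>a' i p\<bar> \<le> 2 ^ Suc j" using ap[OF i] j(2) by linarith
      then have "a' i p \<in> {-(2 ^ Suc j)..2 ^ Suc j}"
        unfolding abs_le_iff atLeastAtMost_iff by (metis minus_le_iff)
      ultimately show ?thesis
        using norm_le[OF i l(1)] b'[OF i] by (auto simp: dyadic_block_def)
    qed
    have "t \<in> (\<Pi>\<^sub>E i\<in>{..<k}. ?F i)"
    proof (rule PiE_I)
      fix i assume "i \<in> {..<k}"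
      then have i: "i < k" by simp
      show "t i \<in> ?F i"
      proof (cases "i = q")
        case True
        then show ?thesis using block[OF i, of j] j i by (simp add: t_def)
      next
        case False
        have "1 \<le> max (sup_abs r (a' i)) (sup_abs r (a' q))" using aq by simp
        then obtain l where l: "2 ^ l \<le> max (sup_abs r (a' i)) (sup_abs r (a' q))"
            "max (sup_abs r (a' i)) (sup_abs r (a' q)) \<le> 2 ^ Suc l" by (rule ex_dyadic)
        \<comment> \<open>The maximum with the pivot norm appears since reduction can make
          \<open>a' i\<close> much shorter than the pivot, even zero. If that maximum is exactly
          \<open>2 ^ j\<close>, the level obtained may be \<open>j - 1\<close>; hence
          \<open>max j l\<close>.\<close>
        define l' where "l' = max j l"
        have l': "2 ^ l' \<le> max (sup_abs r (a' i)) (sup_abs r (a' q))"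
          using l(1) j(1) by (auto simp: l'_def max_def)
        have "(2 :: int) ^ Suc l \<le> 2 ^ Suc l'" by (intro power_increasing) (auto simp: l'_def)
        then have "sup_abs r (a' i) \<le> 2 ^ Suc l'" using l(2) by linarith
        then have "t i \<in> dyadic_block r p j l' (D * \<rho>)" using block[OF i l'] i by (simp add: t_def)
        moreover have "l' \<in> {j..J}" using le_J[OF i l'] by (simp add: l'_def)
        ultimately show ?thesis using False by auto
      qed
    qed (simp add: t_def)
    moreover have "v = tuple_of r k t"
    proof
      fix m
      show "v m = tuple_of r k t m"
      proof (cases "m < r")
        case True
        then have "v m = (\<Sum>i<k. of_int (a' i m) *\<^sub>R b' i)" using vab eq by simp
        also have "\<dots> = tuple_of r k t m" using True by (simp add: tuple_of_def t_def)
        finally show ?thesis .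
      next
        case False
        then show ?thesis using v by (auto simp: tuple_of_def PiE_iff extensional_def)
      qed
    qed
    ultimately show "v \<in> (\<Union>q<k. \<Union>p<r. \<Union>j\<le>J. tuple_of r k `
       (\<Pi>\<^sub>E i\<in>{..<k}. if i = q then dyadic_block r p j j (D * \<rho>)
                   else \<Union>l\<in>{j..J}. dyadic_block r p j l (D * \<rho>)))"
      using q p jJ by blast
  qed
qed

section \<open>Degenerate tuples of grid points\<close>

lemma card_grid: "card (grid n :: (real ^ 'd::finite) set) = n ^ CARD('d)"
proof -
  let ?P = "(UNIV :: 'd set) \<rightarrow>\<^sub>E {1..n}"
  let ?g = "\<lambda>f. (\<chi> c. real (f c)) :: real ^ 'd"
  have "grid n = ?g ` ?P"
  proof (intro equalityI subsetI)
    fix x :: "real ^ 'd" assume "x \<in> grid n"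
    define f where "f i = nat \<lfloor>x $ i\<rfloor>" for i
    have f: "f i \<in> {1..n} \<and> x $ i = real (f i)" for i
    proof -
      obtain m where "m \<in> {1..n}" "x $ i = real m" using \<open>x \<in> grid n\<close> unfolding grid_def by blast
      then show ?thesis by (simp add: f_def)
    qed
    then have "f \<in> ?P" "?g f = x" by (auto simp: PiE_iff vec_eq_iff)
    then show "x \<in> ?g ` ?P" using imageI[of f ?P ?g] by simp
  qed (auto simp: grid_def PiE_iff)
  moreover have "inj_on ?g ?P" by (auto simp: inj_on_def vec_eq_iff fun_eq_iff)
  ultimately show ?thesis by (simp add: card_image card_PiE)
qed

lemma grid_subset_int_lattice: "grid n \<subseteq> int_lattice"
  unfolding grid_def int_lattice_def by (auto, metis Ints_of_nat)

lemma norm_grid: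
  assumes "x \<in> (grid n :: (real ^ 'd::finite) set)"
  shows "norm x \<le> real CARD('d) * real n"
proof -
  have "\<bar>x $ i\<bar> \<le> real n" for i using assms by (auto simp: grid_def dest!: spec[of _ i])
  then have "(\<Sum>i\<in>UNIV. \<bar>x $ i\<bar>) \<le> (\<Sum>i\<in>(UNIV :: 'd set). real n)" by (intro sum_mono)
  then show ?thesis using norm_le_l1_cart[of x] by simp
qed

text \<open>The left side is the number of levels \<open>0, ..., J\<close>. For
  \<open>n \<ge> 2\<close> the binary logarithm of \<open>n\<close> is at least 1 and absorbs the
  additive constants.\<close>

lemma dyadic_levels_le_log:
  assumes "1 \<le> B"
  shows "\<exists>K>0. \<forall>n\<ge>2. real (nat \<lfloor>log 2 (B * real n)\<rfloor>) + 1 \<le> K * ln (real n)"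
proof (intro exI[of _ "(ln B / ln 2 + 2) / ln 2"] conjI allI impI)
  have l2: "0 < ln (2::real)" by simp
  have lB: "0 \<le> ln B / ln 2" using assms by simp
  then have "0 < ln B / ln 2 + 2" by linarith
  then show "0 < (ln B / ln 2 + 2) / ln 2" using l2 by simp
  fix n :: nat assume n: "n \<ge> 2"
  have Bn: "1 \<le> B * real n" using assms n mult_mono[of 1 B 1 "real n"] by simp
  then have "0 \<le> log 2 (B * real n)" by simp
  then have "real (nat \<lfloor>log 2 (B * real n)\<rfloor>) + 1 \<le> log 2 (B * real n) + 1"
    by simp
  also have "\<dots> = ln B / ln 2 + ln (real n) / ln 2 + 1"
    using assms n by (simp add: log_def ln_mult add_divide_distrib)
  also have "\<dots> \<le> (ln B / ln 2) * (ln (real n) / ln 2) + ln (real n) / ln 2 + ln (real n) / ln 2"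
  proof -
    have x: "1 \<le> ln (real n) / ln 2" using n by (simp add: field_simps)
    show ?thesis using x mult_left_mono[OF x lB] by linarith
  qed
  also have "\<dots> = (ln B / ln 2 + 2) / ln 2 * ln (real n)"
    by (simp add: field_simps)
  finally show "real (nat \<lfloor>log 2 (B * real n)\<rfloor>) + 1 \<le> (ln B / ln 2 + 2) / ln 2 * ln (real n)" .
qed

text \<open>The pivot pair contributes O(n^d 2^(-j (d - r))) choices and each other pair O(n^d).
  Summation over \<open>j\<close> is a convergent geometric series for \<open>r < d\<close>, and
  consists of O(log n) equal terms for \<open>r = d\<close>.\<close>

lemma card_degenerate_tuples:
  assumes r: "0 < r" "r \<le> CARD('d::finite)" and k: "0 < k"
  shows "\<exists>K\<ge>1. \<forall>n\<ge>2. real (card (degenerate_tuples r k (grid n :: (real ^ 'd) set)))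
     \<le> K * real n ^ (CARD('d) * k) * (if r < CARD('d) then 1 else ln (real n))"
proof -
  let ?d = "CARD('d)"
  obtain C where C1: "C \<ge> 1" and cover: "\<forall>X \<rho> J. 1 \<le> \<rho> \<longrightarrow> X \<subseteq> int_lattice \<longrightarrow> (\<forall>x\<in>X. norm x \<le> \<rho>) \<longrightarrow>
     (\<forall>l. 2 ^ l \<le> C * \<rho> \<longrightarrow> l \<le> J) \<longrightarrow>
     degenerate_tuples r k (X :: (real ^ 'd) set) \<subseteq> (\<Union>q<k. \<Union>p<r. \<Union>j\<le>J. tuple_of r k `
       (\<Pi>\<^sub>E i\<in>{..<k}. if i = q then dyadic_block r p j j (C * \<rho>)
                   else \<Union>l\<in>{j..J}. dyadic_block r p j l (C * \<rho>)))"
    using degenerate_tuples_cover[OF r(1) k, where 'd = 'd] by blast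
  define B where "B = C * real ?d"
  have "1 \<le> real ?d" using zero_less_card_finite[where 'a = 'd] by linarith
  then have B1: "1 \<le> B" using C1 mult_mono[of 1 C 1 "real ?d"] by (simp add: B_def)
  obtain K\<^sub>0 where K\<^sub>0: "K\<^sub>0 > 0" "\<And>n. n \<ge> 2 \<Longrightarrow> real (nat \<lfloor>log 2 (B * real n)\<rfloor>) + 1 \<le> K\<^sub>0 * ln (real n)"
    using dyadic_levels_le_log[OF B1] by blast
  define G where "G = 5 ^ r * (3 * B) ^ ?d"
  have G0: "0 \<le> G" using B1 by (simp add: G_def)
  \<comment> \<open>\<open>K\<^sub>0\<close> pays for the number of levels, \<open>2\<close> for the
    geometric series, and the last \<open>1\<close> ensures \<open>1 \<le> K\<close>.\<close>
  define K where "K = real k * real r * (2 * G) ^ k * (K\<^sub>0 + 2) + 1"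
  have "0 \<le> real k * real r * (2 * G) ^ k * (K\<^sub>0 + 2)" using G0 K\<^sub>0 by simp
  then have K1: "1 \<le> K" by (simp add: K_def)
  have "real (card (degenerate_tuples r k (grid n :: (real ^ 'd) set)))
     \<le> K * real n ^ (?d * k) * (if r < ?d then 1 else ln (real n))" (is "_ \<le> _ * ?h") if n: "n \<ge> 2" for n
  proof -
    define R where "R = B * real n"
    define J where "J = nat \<lfloor>log 2 R\<rfloor>"
    have R1: "1 \<le> R" using B1 n mult_mono[of 1 B 1 "real n"] by (simp add: R_def)
    have lR: "0 \<le> log 2 R" using R1 by simp
    have "real J \<le> log 2 R" using lR by (simp add: J_def)
    then have "2 powr real J \<le> R" using R1 by (simp add: le_log_iff)
    then have J: "2 ^ J \<le> R" by (simp add: powr_realpow)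
    have J': "l \<le> J" if "2 ^ l \<le> R" for l
    proof -
      have "real l \<le> log 2 R" using that R1 by (simp add: le_log_iff powr_realpow)
      then have "int l \<le> \<lfloor>log 2 R\<rfloor>" by (simp add: le_floor_iff)
      then show ?thesis by (simp add: J_def)
    qed
    define M where "M = 5 ^ r * (3 * R) ^ ?d"
    have MG: "M = G * real n ^ ?d" by (simp add: M_def G_def R_def power_mult_distrib)
    have M0: "0 \<le> M" using R1 by (simp add: M_def)
    \<comment> \<open>An upper bound for the level-dependent factor of the pivot block; for
      \<open>r < d\<close> one factor \<open>1 / 2 ^ j\<close> is enough for convergence.\<close>
    define w where "w j = (if r < ?d then 1 / 2 ^ j else 1 :: real)" for j :: nat
    let ?Q = "\<lambda>p j. \<Union>l\<in>{j..J}. dyadic_block r p j l R :: ((nat \<Rightarrow> int) \<times> (real ^ 'd)) set"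
    let ?D = "\<lambda>p j. dyadic_block r p j j R :: ((nat \<Rightarrow> int) \<times> (real ^ 'd)) set"
    let ?T = "\<lambda>q p j. \<Pi>\<^sub>E i\<in>{..<k}. if i = q then ?D p j else ?Q p j"
    have pieces: "finite (?T q p j)" "real (card (?T q p j)) \<le> (2 * M) ^ k * w j"
      if q: "q < k" and p: "p < r" and j: "j \<le> J" for q p j
    proof -
      have Rj: "2 ^ j \<le> R" using power_increasing[OF j, of "2::real"] J by linarith
      have fD: "finite (?D p j)" and cD: "real (card (?D p j)) \<le> M * (2 ^ j * 2 ^ (j * (r - 1)) / 2 ^ (j * ?d))"
        using card_dyadic_block[OF p Rj, where 'd = 'd] by (auto simp: M_def)
      have fQ: "finite (?Q p j)" and cQ: "real (card (?Q p j)) \<le> 2 * M"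
        using card_dyadic_union[OF p J r(2)] by (auto simp: M_def)
      show "finite (?T q p j)" using fD fQ by (intro finite_PiE) auto
      have "2 ^ j * 2 ^ (j * (r - 1)) = (2::real) ^ (j * r)"
        using r by (simp add: power_add[symmetric] algebra_simps)
      moreover have "(2::real) ^ (j * r) / 2 ^ (j * ?d) \<le> w j"
      proof (cases "r < ?d")
        case True
        then have "(2::real) ^ (j * r + j) \<le> 2 ^ (j * ?d)"
          using mult_le_mono2[of "Suc r" ?d j] by (intro power_increasing) auto
        then show ?thesis using True by (simp add: w_def power_add field_simps)
      next
        case False
        then show ?thesis using r by (simp add: w_def)
      qed
      ultimately have "M * (2 ^ j * 2 ^ (j * (r - 1)) / 2 ^ (j * ?d)) \<le> M * w j"
        using M0 by (intro mult_left_mono) auto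
      then have cD': "real (card (?D p j)) \<le> 2 * M * w j"
        using cD M0 mult_nonneg_nonneg[OF M0, of "w j"] by (simp add: w_def split: if_splits)
      have "card (?T q p j) = (\<Prod>i<k. if i = q then card (?D p j) else card (?Q p j))"
        by (subst card_PiE) (auto intro!: prod.cong)
      also have "\<dots> = card (?D p j) * card (?Q p j) ^ (k - 1)"
        using q by (subst prod.remove[of _ q]) (auto simp: card_Diff_singleton)
      finally have "real (card (?T q p j)) = real (card (?D p j)) * real (card (?Q p j)) ^ (k - 1)"
        by (simp only: of_nat_mult of_nat_power)
      also have "\<dots> \<le> (2 * M * w j) * (2 * M) ^ (k - 1)"
        using cD' cQ M0 by (intro mult_mono power_mono) (auto simp: w_def)
      also have "\<dots> = (2 * M) ^ k * w j" using k by (simp add: power_eq_if[of _ k])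
      finally show "real (card (?T q p j)) \<le> (2 * M) ^ k * w j" .
    qed
    have \<rho>: "1 \<le> real ?d * real n" using n mult_mono[of 1 "real ?d" 1 "real n"] \<open>1 \<le> real ?d\<close> by simp
    have CR: "C * (real ?d * real n) = R" by (simp add: R_def B_def)
    have sub: "degenerate_tuples r k (grid n :: (real ^ 'd) set) \<subseteq> (\<Union>q<k. \<Union>p<r. \<Union>j\<le>J. tuple_of r k ` ?T q p j)"
      using cover[rule_format, of "real ?d * real n" "grid n" J, OF \<rho> grid_subset_int_lattice norm_grid] J' unfolding CR by blast
    have "finite (\<Union>q<k. \<Union>p<r. \<Union>j\<le>J. tuple_of r k ` ?T q p j)"
      using pieces(1) by (intro finite_UN_I finite_imageI) auto
    then have "card (degenerate_tuples r k (grid n :: (real ^ 'd) set))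
        \<le> card (\<Union>q<k. \<Union>p<r. \<Union>j\<le>J. tuple_of r k ` ?T q p j)"
      using sub by (rule card_mono)
    also have "\<dots> \<le> (\<Sum>q<k. card (\<Union>p<r. \<Union>j\<le>J. tuple_of r k ` ?T q p j))"
      by (rule card_UN_le) simp
    also have "\<dots> \<le> (\<Sum>q<k. \<Sum>p<r. card (\<Union>j\<le>J. tuple_of r k ` ?T q p j))"
      by (intro sum_mono card_UN_le) simp
    also have "\<dots> \<le> (\<Sum>q<k. \<Sum>p<r. \<Sum>j\<le>J. card (tuple_of r k ` ?T q p j))"
      by (intro sum_mono card_UN_le) simp
    also have "\<dots> \<le> (\<Sum>q<k. \<Sum>p<r. \<Sum>j\<le>J. card (?T q p j))"
      using pieces(1) by (intro sum_mono card_image_le) auto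
    finally have "real (card (degenerate_tuples r k (grid n :: (real ^ 'd) set)))
        \<le> real (\<Sum>q<k. \<Sum>p<r. \<Sum>j\<le>J. card (?T q p j))" by (simp only: of_nat_le_iff)
    also have "\<dots> = (\<Sum>q<k. \<Sum>p<r. \<Sum>j\<le>J. real (card (?T q p j)))" by (simp only: of_nat_sum)
    also have "\<dots> \<le> (\<Sum>q<k. \<Sum>p<r. \<Sum>j\<le>J. (2 * M) ^ k * w j)"
      using pieces(2) by (intro sum_mono) auto
    also have "\<dots> = real k * real r * (2 * M) ^ k * (\<Sum>j\<le>J. w j)"
      by (simp add: sum_distrib_left[symmetric])
    also have "(\<Sum>j\<le>J. w j) \<le> (K\<^sub>0 + 2) * ?h"
    proof (cases "r < ?d")
      case True
      then show ?thesis using sum_dyadic_tail[of 0 J] K\<^sub>0(1) by (simp add: w_def atMost_atLeast0)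
    next
      case False
      have "0 \<le> ln (real n)" using n by simp
      then show ?thesis using False K\<^sub>0(2)[OF n] by (simp add: w_def J_def R_def algebra_simps)
    qed
    also have "real k * real r * (2 * M) ^ k * ((K\<^sub>0 + 2) * ?h)
        = (K - 1) * real n ^ (?d * k) * ?h"
      by (simp add: K_def MG power_mult_distrib power_mult)
    also have "\<dots> \<le> K * real n ^ (?d * k) * ?h"
      using n by (intro mult_right_mono) auto
    finally show ?thesis using M0 by (simp add: mult_left_mono)
  qed
  then show ?thesis using K1 by blast
qed

subsection \<open>Lower bounds\<close>

text \<open>Admissible sets are the independent sets of the hypergraph whose edges are the
  degenerate \<open>r\<close>-subsets of the grid. The edge count permits q of order (n^(d (k - 1))
  h)^(1/(r - 1)), where h is 1 or log n, and an independent set of order n^d / q.\<close>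

lemma f_lin_lower_bound:
  assumes k: "0 < k" and kr: "k < r" and rd: "r \<le> CARD('d::finite)"
  shows "\<exists>c>0. \<forall>n\<ge>2. c * (real n powr (real CARD('d) * (real r - real k) / (real r - 1))
       / (if r < CARD('d) then 1 else ln (real n)) powr (1 / (real r - 1))) \<le> real (f_lin TYPE('d) n k r)"
proof -
  let ?d = "CARD('d)"
  have r0: "0 < r" and r1: "0 < real r - 1" using k kr by auto
  obtain K where K1: "1 \<le> K" and K: "\<And>n. n \<ge> 2 \<Longrightarrow> real (card (degenerate_tuples r k (grid n :: (real ^ 'd) set)))
     \<le> K * real n ^ (?d * k) * (if r < ?d then 1 else ln (real n))"
    using card_degenerate_tuples[OF r0 rd k] by blast
  define s where "s = 1 / (real r - 1)"
  \<comment> \<open>The 4 is the factor 2 of the deletion method times the factor 2 lost in rounding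
    \<open>q\<close> up.\<close>
  define c where "c = 1 / (4 * (2 * K) powr s)"
  have c0: "c > 0" using K1 by (simp add: c_def)
  have "c * (real n powr (real ?d * (real r - real k) / (real r - 1))
       / (if r < ?d then 1 else ln (real n)) powr s) \<le> real (f_lin TYPE('d) n k r)"
    (is "c * (_ / ?h powr s) \<le> _") if n: "n \<ge> 2" for n
  proof -
    let ?V = "grid n :: (real ^ 'd) set"
    define E where "E = {e. e \<subseteq> ?V \<and> card e = r \<and> (\<exists>W. subspace W \<and> dim W = k \<and> e \<subseteq> W)}"
    have finD: "finite (degenerate_tuples r k ?V)"
    proof (rule finite_subset)
      show "degenerate_tuples r k ?V \<subseteq> {..<r} \<rightarrow>\<^sub>E ?V" unfolding degenerate_tuples_def by (rule Collect_restrict)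
    qed (intro finite_PiE finite_lessThan finite_grid)
    have "E \<subseteq> (\<lambda>v. v ` {..<r}) ` degenerate_tuples r k ?V"
    proof
      fix e assume "e \<in> E"
      then obtain W where e: "e \<subseteq> ?V" "card e = r" and W: "subspace W" "dim W = k" "e \<subseteq> W"
        by (auto simp: E_def)
      have "finite e" using e finite_grid finite_subset by blast
      then obtain g where g: "bij_betw g {..<r} e"
        using ex_bij_betw_nat_finite[of e] e by (auto simp: atLeast0LessThan)
      have ge: "restrict g {..<r} ` {..<r} = e" using g by (simp add: bij_betw_def)
      have "restrict g {..<r} \<in> degenerate_tuples r k ?V"
        using ge e(1) W unfolding degenerate_tuples_def by auto
      then show "e \<in> (\<lambda>v. v ` {..<r}) ` degenerate_tuples r k ?V"
        using ge by blast
    qed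
    then have "card E \<le> card (degenerate_tuples r k ?V)"
      using finD by (metis card_image_le card_mono finite_imageI le_trans)
    then have cE: "real (card E) \<le> K * real n ^ (?d * k) * ?h" using K[OF n] by linarith
    \<comment> \<open>At \<open>n = 2\<close> the logarithm is below 1; the bound
      \<open>1/2\<close>, with the factor 2 in \<open>Y\<close>, still gives
      \<open>1 \<le> Y\<close>.\<close>
    have "2/3 \<le> ln (2::real)" using ln2_ge_two_thirds by simp
    moreover have "ln 2 \<le> ln (real n)" using n by simp
    ultimately have h: "1/2 \<le> ?h" by simp
    \<comment> \<open>\<open>Y * card ?V\<close> bounds twice the number of edges, so sparsity holds
      once \<open>Y \<le> q ^ (r - 1)\<close>; this dictates \<open>q\<close> as the rounded-up root
      of \<open>Y\<close>.\<close>
    define Y where "Y = 2 * K * real n ^ (?d * (k - 1)) * ?h"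
    have "1 * 1 \<le> K * real n ^ (?d * (k - 1))" using K1 n by (intro mult_mono) auto
    then have "1 * 1 \<le> (K * real n ^ (?d * (k - 1))) * (2 * ?h)" using h by (intro mult_mono) auto
    then have Y1: "1 \<le> Y" by (simp add: Y_def mult_ac)
    define q where "q = nat \<lceil>Y powr s\<rceil>"
    have Ys: "1 \<le> Y powr s" using Y1 r1 by (simp add: s_def ge_one_powr_ge_zero)
    have qY: "Y powr s \<le> real q" using Ys by (simp add: q_def)
    have "real q \<le> Y powr s + 1" unfolding q_def using Ys by linarith
    then have q2: "real q \<le> 2 * Y powr s" using Ys by linarith
    have q0: "0 < q" using qY Ys by linarith
    have "Y = (Y powr s) powr (real r - 1)" using Y1 r1 by (simp add: powr_powr s_def)
    also have "\<dots> = (Y powr s) ^ (r - 1)"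
      using Y1 r0 by (subst powr_realpow[symmetric]) (auto simp: of_nat_diff)
    also have "\<dots> \<le> real q ^ (r - 1)" using qY by (intro power_mono) auto
    finally have Yq: "Y \<le> real q ^ (r - 1)" .
    have "real (2 * card E) \<le> Y * real n ^ ?d"
    proof -
      have "?d * k = ?d * (k - 1) + ?d" using k by (cases k) auto
      then have "real n ^ (?d * k) = real n ^ (?d * (k - 1)) * real n ^ ?d" by (simp add: power_add)
      then show ?thesis using cE by (simp add: Y_def mult_ac)
    qed
    also have "\<dots> \<le> real q ^ (r - 1) * real n ^ ?d" using Yq by (intro mult_right_mono) auto
    also have "\<dots> = real (q ^ (r - 1) * card ?V)" by (simp add: card_grid)
    finally have sparse: "2 * card E \<le> q ^ (r - 1) * card ?V" by (simp only: of_nat_le_iff)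
    obtain S where S: "S \<subseteq> ?V" "\<And>e. e \<in> E \<Longrightarrow> \<not> e \<subseteq> S" "card ?V \<le> 2 * q * card S"
      using large_independent_set[OF finite_grid _ q0 r0 sparse] by (auto simp: E_def)
    have "admissible n k r S"
      unfolding admissible_def
    proof (intro conjI allI impI S(1))
      fix W :: "(real ^ 'd) set" assume W: "subspace W \<and> dim W = k"
      show "card (S \<inter> W) \<le> r - 1"
      proof (rule ccontr)
        assume "\<not> ?thesis"
        then have "r \<le> card (S \<inter> W)" by linarith
        then obtain e where e: "e \<subseteq> S \<inter> W" "card e = r" by (meson obtain_subset_with_card_n)
        then have "e \<in> E" using W S(1) unfolding E_def by blast
        then show False using S(2) e by blast
      qed
    qed
    then have "card S \<le> f_lin TYPE('d) n k r" by (rule f_lin_max(2))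
    then have "card ?V \<le> 2 * q * f_lin TYPE('d) n k r"
      using S(3) mult_le_mono2 order_trans by blast
    then have "real (n ^ ?d) \<le> real (2 * q * f_lin TYPE('d) n k r)" unfolding card_grid of_nat_le_iff .
    then have "real n ^ ?d \<le> 2 * real q * real (f_lin TYPE('d) n k r)" by simp
    also have "\<dots> \<le> 2 * (2 * Y powr s) * real (f_lin TYPE('d) n k r)"
      using q2 by (intro mult_right_mono) auto
    finally have *: "real n ^ ?d \<le> real (f_lin TYPE('d) n k r) * (4 * Y powr s)" by (simp add: mult_ac)
    have main: "real n ^ ?d / (4 * Y powr s) \<le> real (f_lin TYPE('d) n k r)"
    proof -
      have "0 < 4 * Y powr s" using Ys by linarith
      then show ?thesis using * by (simp only: pos_divide_le_eq mult_ac)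
    qed
    have "Y powr s = (2 * K) powr s * (real n ^ (?d * (k - 1))) powr s * ?h powr s"
      unfolding Y_def using K1 h n by (simp add: powr_mult)
    also have "(real n ^ (?d * (k - 1))) powr s = real n powr (real ?d * (real k - 1) * s)"
      using n k by (simp add: powr_realpow[symmetric] powr_powr of_nat_diff)
    finally have "real n ^ ?d / (4 * Y powr s)
        = c * (real n powr real ?d / real n powr (real ?d * (real k - 1) * s) / ?h powr s)"
      using n by (simp add: c_def powr_realpow)
    \<comment> \<open>The exponents combine as d - d (k - 1)/(r - 1) = d (r - k)/(r - 1).\<close>
    also have "real n powr real ?d / real n powr (real ?d * (real k - 1) * s)
        = real n powr (real ?d * (real r - real k) / (real r - 1))"
      using r1 by (simp add: powr_diff[symmetric] s_def field_simps)
    finally show ?thesis using main by simp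
  qed
  then show ?thesis using c0 unfolding s_def by blast
qed

text \<open>Relaxing the bound keeps sets admissible; this carries the case \<open>r = d\<close>
  over to all larger \<open>r\<close>.\<close>

lemma f_lin_mono:
  assumes "r \<le> r'"
  shows "f_lin TYPE('d::finite) n k r \<le> f_lin TYPE('d) n k r'"
proof -
  obtain S :: "(real ^ 'd) set" where S: "admissible n k r S" "card S = f_lin TYPE('d) n k r"
    using f_lin_max(1) by blast
  have "r - 1 \<le> r' - 1" using assms by simp
  then have "card (S \<inter> V) \<le> r' - 1" if "subspace V" "dim V = k" for V
    using S(1) that order_trans unfolding admissible_def by blast
  then have "admissible n k r' S" using S(1) by (simp add: admissible_def)
  then show ?thesis using f_lin_max(2)[of n k r' S "TYPE('d)"] S(2) by simp
qed

lemma f_lin_bigomega: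
  assumes k: "0 < k" and kr: "k < r" and kd: "k < CARD('d::finite)"
  shows "(\<lambda>n. real (f_lin TYPE('d) n k r)) \<in> \<Omega>(g_dkr CARD('d) k r)"
proof -
  \<comment> \<open>From \<open>r = d\<close> on, \<open>g_dkr\<close> is constant in
    \<open>r\<close>, so capping \<open>r\<close> at the dimension loses nothing;
    \<open>k < r'\<close> survives by \<open>kd\<close>.\<close>
  define r' where "r' = min r CARD('d)"
  have r': "k < r'" "r' \<le> CARD('d)" "r' \<le> r" using kr kd by (auto simp: r'_def)
  obtain c where c: "c > 0" "\<And>n. n \<ge> 2 \<Longrightarrow> c * (real n powr (real CARD('d) * (real r' - real k) / (real r' - 1))
       / (if r' < CARD('d) then 1 else ln (real n)) powr (1 / (real r' - 1))) \<le> real (f_lin TYPE('d) n k r')"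
    using f_lin_lower_bound[OF k r'(1,2)] by blast
  show ?thesis
  proof (rule landau_omega.bigI[OF c(1)])
    show "\<forall>\<^sub>F n in sequentially. c * norm (g_dkr CARD('d) k r n) \<le> norm (real (f_lin TYPE('d) n k r))"
      using eventually_ge_at_top[of 2]
    proof eventually_elim
      case (elim n)
      have "norm (g_dkr CARD('d) k r n) = real n powr (real CARD('d) * (real r' - real k) / (real r' - 1))
         / (if r' < CARD('d) then 1 else ln (real n)) powr (1 / (real r' - 1))"
        by (auto simp: g_dkr_def r'_def min_def)
      then have "c * norm (g_dkr CARD('d) k r n) \<le> real (f_lin TYPE('d) n k r')" using c(2)[OF elim] by simp
      then show ?case using f_lin_mono[OF r'(3), where 'd = 'd, of n k] by simp
    qed
  qed
qed

theorem theorem1p2: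
  fixes d k r :: nat
  assumes "CARD('d::finite) = d"
    and "0 < k" and "k < d" and "k + 1 \<le> r"
  shows "(\<lambda>n. real (f_lin TYPE('d) n k r)) \<in> \<Omega>(g_dkr d k r)
    \<and> (r = k + 1 \<longrightarrow> (\<lambda>n. real (f_lin TYPE('d) n k (k + 1))) \<in> \<Omega>(g_dk d k))"
proof -
  \<comment> \<open>With \<open>r = k + 1\<close>, the condition \<open>r < d\<close> means that
    \<open>k\<close> differs from \<open>d - 1\<close>, and the first exponent becomes
    \<open>d / k\<close>.\<close>
  have "g_dkr d k (k + 1) = g_dk d k"
    using assms(3) by (auto simp: g_dkr_def g_dk_def fun_eq_iff)
  moreover have "(\<lambda>n. real (f_lin TYPE('d) n k r)) \<in> \<Omega>(g_dkr d k r)"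
    using f_lin_bigomega[of k r, where 'd = 'd] assms by simp
  ultimately show ?thesis by metis
qed

end
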